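(* Assume $\ell(w,z)\in[0,1]$ for all $w,z$. Then $$|\mathcal{E}_{\mathcal{D}}(\mathcal{A})|\le \frac1K\sum_{i=1}^K\mathbb{E}_{\widetilde{Z}^i,U^i}\sqrt{2I^{\widetilde{Z}^i,U^i}(W;V_i)}+\frac{1}{Kn}\sum_{i=1}^K\sum_{j=1}^n\mathbb{E}_{\widetilde{Z}^i,V_i}\sqrt{2I^{\widetilde{Z}^i,V_i}(W;U^{i,V_i}_j)}.$$ Moreover the first sum bounds $|\mathcal{E}_{PG}(\mathcal{A})|$ and the second bounds $|\mathcal{E}_{OG}(\mathcal{A})|$.
   Context: Setting. $\mathcal{Z}$ is an instance space, $\mathcal{W}$ a hypothesis space, $\mathcal{C}$ a set of clients; each client $c\in\mathcal{C}$ has a data distribution $\mu_c$ on $\mathcal{Z}$, and $\mathcal{D}$ is a probability distribution on $\mathcal{C}$ (so a draw from $\mathcal{D}$ yields a data distribution on $\mathcal{Z}$). A loss $\ell:\mathcal{W}\times\mathcal{Z}\to[0,\infty)$ is given. There are $K$ participating clients, each with $n$ training points. A federated learning (FL) algorithm $\mathcal{A}$ is a conditional distribution $P_{W|S}$ mapping the collective training sample $S=(S_1,\dots,S_K)\in\mathcal{Z}^{nK}$ to a hypothesis $W\in\mathcal{W}$; it consists of local algorithms $\mathcal{A}_i$ (conditional distributions $P_{W_i|S_i}$ producing local models $W_i$ from $S_i$, independently across clients given the data) followed by a server aggregation of $(W_1,\dots,W_K)$ into $W$. Superclient/supersample construction. Let $\tilde\mu=(\tilde\mu_{i,b})_{i\in[K],b\in\{0,1\}}$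 have i.i.d. entries drawn from $\mathcal{D}$. Conditionally on $\tilde\mu$, for each $(i,b)$ let $\widetilde{Z}^{i,b}=(\widetilde{Z}^{i,b}_{j,c})_{j\in[n],c\in\{0,1\}}$ have i.i.d. entries drawn from $\tilde\mu_{i,b}$, independently over $(i,b)$. Let $V=(V_1,\dots,V_K)$ and $U^{i,b}=(U^{i,b}_j)_{j\in[n]}$ ($i\in[K]$, $b\in\{0,1\}$) be mutually independent $\mathrm{Unif}\{0,1\}$ random variables, independent of $(\tilde\mu,\widetilde{Z})$. Write $\overline{V}_i=1-V_i$, $\overline{U}^{i,b}_j=1-U^{i,b}_j$, $\widetilde{Z}^i=(\widetilde{Z}^{i,0},\widetilde{Z}^{i,1})$, $U^i=(U^{i,0},U^{i,1})$, $\widetilde{Z}=(\widetilde{Z}^i)_{i\in[K]}$, $U=(U^i)_{i\in[K]}$. The $i$-th participating client distribution is $\mu_i=\tilde\mu_{i,V_i}$ and its training set is $S_i=(Z_{i,1},\dots,Z_{i,n})$ with $Z_{i,j}=\widetilde{Z}^{i,V_i}_{j,U^{i,V_i}_j}$; $S=(S_1,\dots,S_K)$. Given all of these variables, $W\sim P_{W|S}$ (so $W$ depends on $(\tilde\mu,\widetilde{Z},V,U)$ only through $S$), and likewise $W_i\sim P_{W_i|S_i}$. Risks. $L_{\mathcal{D}}(w)=\mathbb{E}_{\mu\sim\mathcal{D}}\mathbb{E}_{Z\sim\mu}\ell(w,Z)$; $L_{\mu_i}(w)=\mathbb{E}_{Z\sim\mu_i}\ell(w,Z)$; $L_{\mu_{[K]}}(w)=\frac1K\sum_{i=1}^K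 L_{\mu_i}(w)$; $L_S(w)=\frac{1}{Kn}\sum_{i=1}^K\sum_{j=1}^n\ell(w,Z_{i,j})$. Generalization error $\mathcal{E}_{\mathcal{D}}(\mathcal{A})=\mathbb{E}[L_{\mathcal{D}}(W)]-\mathbb{E}[L_S(W)]$; participation gap $\mathcal{E}_{PG}(\mathcal{A})=\mathbb{E}[L_{\mathcal{D}}(W)]-\mathbb{E}[L_{\mu_{[K]}}(W)]$; out-of-sample gap $\mathcal{E}_{OG}(\mathcal{A})=\mathbb{E}[L_{\mu_{[K]}}(W)]-\mathbb{E}[L_S(W)]$. Information measures. $I(X;Y)$ is mutual information, $I(X;Y|Z)$ conditional mutual information; the disintegrated mutual information is $I^{z}(X;Y)=\mathrm{D_{KL}}(P_{X,Y|Z=z}\,\|\,P_{X|Z=z}\otimes P_{Y|Z=z})$, so that $I(X;Y|Z)=\mathbb{E}_Z[I^{Z}(X;Y)]$. *)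

theory Defs
  imports "HOL-Probability.Probability"
begin

definition coin :: "bool measure" where
  "coin = measure_pmf (pmf_of_set (UNIV :: bool set))"

text \<open>Per-superclient random variables: the two client distributions
  (mu_{i,0}, mu_{i,1}), the supersample Zt^i with Zt^i b j c = Zt^{i,b}_{j,c},
  the bit V_i, and the bits U^i with U^i b j = U^{i,b}_j.\<close>
type_synonym 'z superclient =
  "(bool \<Rightarrow> 'z measure) \<times> (bool \<Rightarrow> nat \<Rightarrow> bool \<Rightarrow> 'z) \<times> bool \<times> (bool \<Rightarrow> nat \<Rightarrow> bool)"

definition sc_mu :: "'z superclient \<Rightarrow> bool \<Rightarrow> 'z measure" where
  "sc_mu x = fst x"
definition sc_Z :: "'z superclient \<Rightarrow> bool \<Rightarrow> nat \<Rightarrow> bool \<Rightarrow> 'z" where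
  "sc_Z x = fst (snd x)"
definition sc_V :: "'z superclient \<Rightarrow> bool" where
  "sc_V x = fst (snd (snd x))"
definition sc_U :: "'z superclient \<Rightarrow> bool \<Rightarrow> nat \<Rightarrow> bool" where
  "sc_U x = snd (snd (snd x))"

definition ss_space :: "'z measure \<Rightarrow> nat \<Rightarrow> (nat \<Rightarrow> bool \<Rightarrow> 'z) measure" where
  "ss_space MZ n = PiM {..<n} (\<lambda>_. PiM UNIV (\<lambda>_::bool. MZ))"

definition sc_space :: "'z measure \<Rightarrow> nat \<Rightarrow> 'z superclient measure" where
  "sc_space MZ n =
     PiM UNIV (\<lambda>_::bool. prob_algebra MZ) \<Otimes>\<^sub>M (PiM UNIV (\<lambda>_::bool. ss_space MZ n) \<Otimes>\<^sub>M
       (coin \<Otimes>\<^sub>M PiM UNIV (\<lambda>_::bool. PiM {..<n} (\<lambda>_. coin))))"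

definition superclient_law ::
  "'z measure \<Rightarrow> 'z measure measure \<Rightarrow> nat \<Rightarrow> 'z superclient measure" where
  "superclient_law MZ D n =
     distr
     ((bind (PiM UNIV (\<lambda>_::bool. D))
        (\<lambda>mu. distr (PiM UNIV (\<lambda>b. PiM {..<n} (\<lambda>_. PiM UNIV (\<lambda>_::bool. mu b))))
                     (PiM UNIV (\<lambda>_::bool. prob_algebra MZ) \<Otimes>\<^sub>M PiM UNIV (\<lambda>_::bool. ss_space MZ n))
                     (\<lambda>z. (mu, z))))
      \<Otimes>\<^sub>M (coin \<Otimes>\<^sub>M PiM UNIV (\<lambda>_::bool. PiM {..<n} (\<lambda>_. coin))))
     (sc_space MZ n)
     (\<lambda>((m, z), r). (m, z, r))"

definition omega_law ::
  "'z measure \<Rightarrow> 'z measure measure \<Rightarrow> nat \<Rightarrow> nat \<Rightarrow> (nat \<Rightarrow> 'z superclient) measure" where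
  "omega_law MZ D K n = PiM {..<K} (\<lambda>_. superclient_law MZ D n)"

definition train_sample :: "nat \<Rightarrow> nat \<Rightarrow> (nat \<Rightarrow> 'z superclient) \<Rightarrow> nat \<Rightarrow> nat \<Rightarrow> 'z" where
  "train_sample K n \<omega> =
     (\<lambda>i\<in>{..<K}. \<lambda>j\<in>{..<n}.
        sc_Z (\<omega> i) (sc_V (\<omega> i)) j (sc_U (\<omega> i) (sc_V (\<omega> i)) j))"

definition sample_space :: "'z measure \<Rightarrow> nat \<Rightarrow> nat \<Rightarrow> (nat \<Rightarrow> nat \<Rightarrow> 'z) measure" where
  "sample_space MZ K n = PiM {..<K} (\<lambda>_. PiM {..<n} (\<lambda>_. MZ))"

definition fl_algorithm ::
  "'z measure \<Rightarrow> 'l measure \<Rightarrow> 'w measure \<Rightarrow> nat \<Rightarrow> nat \<Rightarrow> ((nat \<Rightarrow> nat \<Rightarrow> 'z) \<Rightarrow> 'w measure) \<Rightarrow> bool" where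
  "fl_algorithm MZ MWloc MW K n A \<longleftrightarrow>
     A \<in> sample_space MZ K n \<rightarrow>\<^sub>M prob_algebra MW \<and>
     (\<exists>Aloc agg.
        (\<forall>i<K. Aloc i \<in> PiM {..<n} (\<lambda>_. MZ) \<rightarrow>\<^sub>M prob_algebra MWloc) \<and>
        agg \<in> PiM {..<K} (\<lambda>_. MWloc) \<rightarrow>\<^sub>M prob_algebra MW \<and>
        (\<forall>s\<in>space (sample_space MZ K n).
           A s = bind (PiM {..<K} (\<lambda>i. Aloc i (s i))) agg))"

definition risk_mu :: "('w \<Rightarrow> 'z \<Rightarrow> real) \<Rightarrow> 'z measure \<Rightarrow> 'w \<Rightarrow> real" where
  "risk_mu loss \<mu> w = (\<integral>z. loss w z \<partial>\<mu>)"

definition risk_D :: "('w \<Rightarrow> 'z \<Rightarrow> real) \<Rightarrow> 'z measure measure \<Rightarrow> 'w \<Rightarrow> real" where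
  "risk_D loss D w = (\<integral>\<mu>. risk_mu loss \<mu> w \<partial>D)"

definition exp_pop_risk where
  "exp_pop_risk MZ D K n A loss =
     (\<integral>\<omega>. (\<integral>w. risk_D loss D w \<partial>(A (train_sample K n \<omega>))) \<partial>(omega_law MZ D K n))"

definition exp_part_risk where
  "exp_part_risk MZ D K n A loss =
     (\<integral>\<omega>. (\<integral>w. (1 / real K) * (\<Sum>i<K. risk_mu loss (sc_mu (\<omega> i) (sc_V (\<omega> i))) w)
        \<partial>(A (train_sample K n \<omega>))) \<partial>(omega_law MZ D K n))"

definition exp_emp_risk where
  "exp_emp_risk MZ D K n A loss =
     (\<integral>\<omega>. (\<integral>w. (1 / (real K * real n)) *
          (\<Sum>i<K. \<Sum>j<n. loss w (train_sample K n \<omega> i j))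
        \<partial>(A (train_sample K n \<omega>))) \<partial>(omega_law MZ D K n))"

definition gen_error where
  "gen_error MZ D K n A loss = exp_pop_risk MZ D K n A loss - exp_emp_risk MZ D K n A loss"

definition part_gap where
  "part_gap MZ D K n A loss = exp_pop_risk MZ D K n A loss - exp_part_risk MZ D K n A loss"

definition out_gap where
  "out_gap MZ D K n A loss = exp_part_risk MZ D K n A loss - exp_emp_risk MZ D K n A loss"

text \<open>KL divergence D(N || M) with value \<infinity> when N is not absolutely continuous
  w.r.t. M or the log-density is not N-integrable.\<close>
definition KL_ext :: "'a measure \<Rightarrow> 'a measure \<Rightarrow> ennreal" where
  "KL_ext M N =
     (if absolutely_continuous M N \<and> integrable N (entropy_density (exp 1) M N)
      then ennreal (KL_divergence (exp 1) M N) else \<infinity>)"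

definition mutual_info_ext :: "'a measure \<Rightarrow> 'b measure \<Rightarrow> ('a \<times> 'b) measure \<Rightarrow> ennreal" where
  "mutual_info_ext MX MY J = KL_ext (distr J MX fst \<Otimes>\<^sub>M distr J MY snd) J"

definition sqrt2_ext :: "ennreal \<Rightarrow> ennreal" where
  "sqrt2_ext x = (if x = \<infinity> then \<infinity> else ennreal (sqrt (2 * enn2real x)))"

text \<open>Conditional law of W given (Zt^i, U^i, V_i) = (zt, u, v): all other variables
  are independent of these and keep their law; W depends only on S.\<close>
definition Wlaw_V where
  "Wlaw_V MZ D K n A i zt v u =
     bind (omega_law MZ D K n)
       (\<lambda>\<omega>. A (train_sample K n (fun_upd \<omega> i (sc_mu (\<omega> i), zt, v, u))))"

definition joint_W_V where
  "joint_W_V MZ MW D K n A i zt u =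
     bind coin (\<lambda>v. distr (Wlaw_V MZ D K n A i zt v u) (MW \<Otimes>\<^sub>M coin) (\<lambda>w. (w, v)))"

text \<open>Conditional law of W given (Zt^i, V_i, U^{i,V_i}_j) = (zt, v, c).\<close>
definition Wlaw_U where
  "Wlaw_U MZ D K n A i j zt v c =
     bind (omega_law MZ D K n)
       (\<lambda>\<omega>. A (train_sample K n
          (fun_upd \<omega> i (sc_mu (\<omega> i), zt, v, fun_upd (sc_U (\<omega> i)) v (fun_upd (sc_U (\<omega> i) v) j c)))))"

definition joint_W_U where
  "joint_W_U MZ MW D K n A i j zt v =
     bind coin (\<lambda>c. distr (Wlaw_U MZ D K n A i j zt v c) (MW \<Otimes>\<^sub>M coin) (\<lambda>w. (w, c)))"

definition bound_PG where
  "bound_PG MZ MW D K n A =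
     ennreal (1 / real K) *
     (\<Sum>i<K. \<integral>\<^sup>+\<omega>. sqrt2_ext (mutual_info_ext MW coin
                 (joint_W_V MZ MW D K n A i (sc_Z (\<omega> i)) (sc_U (\<omega> i))))
            \<partial>(omega_law MZ D K n))"

definition bound_OG where
  "bound_OG MZ MW D K n A =
     ennreal (1 / (real K * real n)) *
     (\<Sum>i<K. \<Sum>j<n. \<integral>\<^sup>+\<omega>. sqrt2_ext (mutual_info_ext MW coin
                 (joint_W_U MZ MW D K n A i j (sc_Z (\<omega> i)) (sc_V (\<omega> i))))
            \<partial>(omega_law MZ D K n))"

end

theory Submission
  imports Defs
begin

text \<open>
  Everything happens inside one superclient. Averaging over the other superclients turns the algorithm
  into a Markov kernel from the training row of client \<open>i\<close> to hypotheses. The training row never reads the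
  supersample points with the complementary bits, so such a point is a fresh draw: at the unselected client
  it represents the risk under the meta-distribution, at the selected client the risk under that client's
  distribution. Hence both gaps are averages, over the conditioning variables, of
  \<open>g(W, \<not> B) - g(W, B)\<close> for a fair bit \<open>B\<close> (the bit \<open>V\<^sub>i\<close>, respectively \<open>U\<^sub>j\<close>) and some \<open>g\<close> with
  values in \<open>[0, 1]\<close>. This difference lies in \<open>[-1, 1]\<close> and is centred under the product of the marginals
  of \<open>(W, B)\<close>, so Donsker--Varadhan and Hoeffding's lemma bound its mean by the square root of twice the
  mutual information.

  The integrands of the bounds are not shown to be measurable, which is harmless: only monotonicity of the
  nonnegative integral is applied to them.
\<close>

section \<open>A change-of-measure inequality\<close>

text \<open>Each mutual information is estimated at a fixed value of the conditioning variables and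
  averaged only afterwards, which keeps the expectation outside the square root. The price is that
  \<open>g\<close> may depend only on the conditioning variables besides (W, B). For the
  participation gap a single formula in the bit b must yield the client risk at b = V and the
  population risk at the other value. A training point is unsuitable, since at b = V it would give
  the empirical risk, so \<open>g\<close> uses the complementary point on both sides. For the
  out-of-sample gap the two candidate points at position j of the selected client play this part.

  The two conditionings differ in kind. Given the supersample and all of U, the bit V determines the
  training row of the client. Given the supersample, V and one bit of U, the remaining bits are
  still random, so the conditional law of W is a mixture over rows; a second copy of the superclient
  supplies these bits.

  Integrals are exchanged as nonnegative integrals, where measurability suffices; the bound on the
  loss brings the results back to real risks.\<close>

lemma donsker_varadhan_Hoeffding:
  fixes f r :: "'a \<Rightarrow> real"
  assumes P: "prob_space P" and J: "prob_space J" 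
    and r[measurable]: "r \<in> borel_measurable P" and r0: "\<And>x. 0 \<le> r x" and Jr: "J = density P r"
    and int: "integrable J (\<lambda>x. ln (r x))"
    and f[measurable]: "f \<in> borel_measurable P" and bnd: "\<And>x. \<bar>f x\<bar> \<le> 1" and cent: "(\<integral>x. f x \<partial>P) = 0"
    and pos: "0 < (\<integral>x. f x \<partial>J)"
  shows "(\<integral>x. f x \<partial>J)\<^sup>2 \<le> 2 * (\<integral>x. ln (r x) \<partial>J)"
proof -
  interpret P: prob_space P by fact
  interpret J: prob_space J by fact
  \<comment> \<open>For every slope t the argument bounds t m - t^2 / 2 by the divergence, where m
    is the mean of \<open>f\<close> under \<open>J\<close>. The best slope is t = m, so the mean
    itself is used; Hoeffding's lemma wants it positive.\<close>
  define l where "l = (\<integral>x. f x \<partial>J)"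
  have sJ[measurable_cong]: "sets J = sets P" by (simp add: Jr)
  have l: "l > 0" using pos by (simp add: l_def)
  interpret interval_bounded_random_variable P f "-1" 1
    by unfold_locales (use bnd in \<open>auto simp: abs_le_iff minus_le_iff\<close>)
  \<comment> \<open>The Hoeffding exponent is l^2 (b - a)^2 / 8 with b - a = 2; this is the source
    of the factor 2 under the square root.\<close>
  have H: "(\<integral>\<^sup>+x. exp (l * f x) \<partial>P) \<le> ennreal (exp (l\<^sup>2 / 2))"
    using Hoeffdings_lemma_nn_integral_0[OF l cent] by simp
  have bf: "exp (l * f x) \<le> exp l" for x
    using bnd[of x] l by (auto simp: abs_le_iff)
  have iexp: "integrable P (\<lambda>x. exp (l * f x))"
    by (rule P.integrable_const_bound[where B="exp l"]) (use bf in auto)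
  have H': "(\<integral>x. exp (l * f x) \<partial>P) \<le> exp (l\<^sup>2 / 2)"
    using H by (subst (asm) nn_integral_eq_integral[OF iexp]) auto
  have ir: "integrable P r" "(\<integral>x. r x \<partial>P) = 1"
  proof -
    have "(\<integral>\<^sup>+x. r x \<partial>P) = 1"
      using J.emeasure_space_1 by (simp add: Jr emeasure_density cong: nn_integral_cong)
    then show "integrable P r" "(\<integral>x. r x \<partial>P) = 1"
      using r0 by (auto intro!: integrableI_nonneg simp: integral_eq_nn_integral)
  qed
  have "integrable J f"
    by (rule J.integrable_const_bound[where B=1]) (use bnd in auto)
  then have irf: "integrable P (\<lambda>x. r x * f x)" "(\<integral>x. r x * f x \<partial>P) = l"
    using r0 by (auto simp: Jr l_def integrable_real_density integral_real_density)
  have irl: "integrable P (\<lambda>x. r x * ln (r x))" "(\<integral>x. r x * ln (r x) \<partial>P) = (\<integral>x. ln (r x) \<partial>J)"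
    using r0 int by (auto simp: Jr integrable_real_density integral_real_density)
  \<comment> \<open>This is the tangent inequality 1 + y \<le> exp y, weighted by
    \<open>r x\<close>. Subtracting l^2 / 2 in the exponent normalises the exponential moment to at
    most 1, so a linear bound replaces the logarithm in the variational formula. Where
    \<open>r x = 0\<close> the left side vanishes, because 0 times \<open>ln 0\<close> is 0.\<close>
  have pw: "l * (r x * f x) - l\<^sup>2 / 2 * r x - r x * ln (r x) \<le> exp (- (l\<^sup>2 / 2)) * exp (l * f x) - r x" for x
  proof (cases "r x = 0")
    case False
    then have rp: "r x > 0" using r0[of x] by simp
    define y where "y = - (l\<^sup>2 / 2) + l * f x - ln (r x)"
    have "1 + y \<le> exp y" by simp
    also have "exp y = exp (- (l\<^sup>2 / 2)) * exp (l * f x) / r x"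
      by (simp only: y_def exp_diff exp_add exp_ln[OF rp])
    finally have "r x * (1 + y) \<le> exp (- (l\<^sup>2 / 2)) * exp (l * f x)"
      using rp by (simp add: field_simps)
    then show ?thesis by (simp add: y_def algebra_simps)
  qed simp
  have "(\<integral>x. l * (r x * f x) - l\<^sup>2 / 2 * r x - r x * ln (r x) \<partial>P) 
     \<le> (\<integral>x. exp (- (l\<^sup>2 / 2)) * exp (l * f x) - r x \<partial>P)"
    by (intro integral_mono[OF _ _ pw] Bochner_Integration.integrable_diff integrable_mult_right irf irl ir iexp)
  also have "\<dots> = exp (- (l\<^sup>2 / 2)) * (\<integral>x. exp (l * f x) \<partial>P) - 1"
    using iexp ir by simp
  also have "\<dots> \<le> exp (- (l\<^sup>2 / 2)) * exp (l\<^sup>2 / 2) - 1"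
    using H' by simp
  also have "\<dots> = 0" by (simp flip: exp_add)
  finally have "l * l - l\<^sup>2 / 2 - (\<integral>x. ln (r x) \<partial>J) \<le> 0"
    using irf irl ir by simp
  then show ?thesis by (simp add: l_def power2_eq_square)
qed

text \<open>If the divergence is infinite there is nothing to prove; otherwise the Radon-Nikodym
  derivative supplies the density that the preceding inequality asks for.\<close>

lemma abs_expectation_le_sqrt2_KL_ext:
  fixes f :: "'a \<Rightarrow> real"
  assumes P: "prob_space P" and J: "prob_space J" and sets: "sets J = sets P"
    and f[measurable]: "f \<in> borel_measurable P" and bnd: "\<And>x. \<bar>f x\<bar> \<le> 1" and cent: "(\<integral>x. f x \<partial>P) = 0"
  shows "ennreal \<bar>\<integral>x. f x \<partial>J\<bar> \<le> sqrt2_ext (KL_ext P J)"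
proof (cases "absolutely_continuous P J \<and> integrable J (entropy_density (exp 1) P J)")
  case True
  interpret P: prob_space P by fact
  interpret J: prob_space J by fact
  have fin: "finite_measure J" by unfold_locales
  have ac: "absolutely_continuous P J" using True by simp
  define r where "r = (\<lambda>x. enn2real (RN_deriv P J x))"
  have [measurable]: "r \<in> borel_measurable P" by (simp add: r_def)
  have "J = density P (RN_deriv P J)"
    using P.density_RN_deriv[OF ac sets] by simp
  \<comment> \<open>The derivative is finite almost everywhere because \<open>J\<close> is
    sigma-finite, so its real-valued version defines the same density.\<close>
  also have "\<dots> = density P r"
    using P.RN_deriv_finite[OF J.sigma_finite_measure ac sets]
    by (intro density_cong) (auto simp: r_def less_top)
  finally have Jr: "J = density P r" .
  have ed: "entropy_density (exp 1) P J = (\<lambda>x. ln (r x))"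
    by (auto simp: entropy_density_def r_def log_def fun_eq_iff)
  have int: "integrable J (\<lambda>x. ln (r x))" using True by (simp add: ed)
  have KL: "KL_divergence (exp 1) P J = (\<integral>x. ln (r x) \<partial>J)"
    by (simp add: KL_divergence_def ed)
  have r0: "0 \<le> r x" for x by (simp add: r_def)
  let ?k = "\<integral>x. ln (r x) \<partial>J"
  \<comment> \<open>The maximum with 0 mirrors the truncation of negative reals by
    \<open>ennreal\<close> inside \<open>KL_ext\<close>; nonnegativity of the divergence then need
    not be established separately.\<close>
  have "\<bar>\<integral>x. f x \<partial>J\<bar> \<le> sqrt (2 * max 0 ?k)"
  proof -
    \<comment> \<open>The preceding inequality wants a positive mean. A negative mean is handled by
      passing to \<open>- f\<close>, which has the same bound and is again centred.\<close>
    consider "(\<integral>x. f x \<partial>J) = 0" | "(\<integral>x. f x \<partial>J) > 0" | "(\<integral>x. - f x \<partial>J) > 0"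
      by fastforce
    then show ?thesis
    proof cases
      case 2
      have "(\<integral>x. f x \<partial>J)\<^sup>2 \<le> 2 * ?k"
        by (rule donsker_varadhan_Hoeffding[OF P J _ r0 Jr int f bnd cent 2]) measurable
      then show ?thesis by (intro real_le_rsqrt) auto
    next
      case 3
      have "(\<integral>x. - f x \<partial>J)\<^sup>2 \<le> 2 * ?k"
        by (rule donsker_varadhan_Hoeffding[OF P J _ r0 Jr int _ _ _ 3]) (use bnd cent in auto)
      then show ?thesis by (intro real_le_rsqrt) auto
    qed simp
  qed
  moreover have "KL_ext P J = ennreal ?k"
    using True by (simp add: KL_ext_def KL)
  moreover have "enn2real (ennreal ?k) = max 0 ?k"
    by (simp add: max_def enn2real_eq_0_iff ennreal_neg)
  ultimately show ?thesis
    by (auto simp: sqrt2_ext_def intro!: ennreal_leI)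
next
  case False
  then have "KL_ext P J = \<infinity>" unfolding KL_ext_def by (subst if_not_P) auto
  then show ?thesis by (simp add: sqrt2_ext_def)
qed

section \<open>Resampling in product measures\<close>

text \<open>Overwriting one coordinate by an independent draw from its own law leaves a product
  measure unchanged. The first form redraws inside the integral; the second takes the new coordinate
  outside, which separates one superclient from all the others.\<close>

lemma nn_integral_PiM_resample:
  assumes M: "\<And>i. i \<in> I \<Longrightarrow> prob_space (M i)" and i: "i \<in> I"
    and F[measurable]: "F \<in> borel_measurable (PiM I M)"
  shows "(\<integral>\<^sup>+\<omega>. F \<omega> \<partial>PiM I M) = (\<integral>\<^sup>+\<omega>. \<integral>\<^sup>+x. F (fun_upd \<omega> i x) \<partial>M i \<partial>PiM I M)"
    and "(\<integral>\<^sup>+\<omega>. F \<omega> \<partial>PiM I M) = (\<integral>\<^sup>+x. \<integral>\<^sup>+\<omega>. F (fun_upd \<omega> i x) \<partial>PiM I M \<partial>M i)"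
proof -
  interpret Mi: prob_space "M i" using M i by auto
  interpret PI: prob_space "PiM I M" using M by (rule prob_space_PiM)
  interpret PP: pair_sigma_finite "M i" "PiM I M" ..
  have ii: "insert i I = I" using i by auto
  have [measurable]: "(\<lambda>p. fun_upd (snd p) i (fst p)) \<in> M i \<Otimes>\<^sub>M PiM I M \<rightarrow>\<^sub>M PiM I M"
    by (rule measurable_fun_upd[where J=I]) (auto simp: ii)
  have "(\<integral>\<^sup>+\<omega>. F \<omega> \<partial>PiM I M) = (\<integral>\<^sup>+\<omega>. F \<omega> \<partial>distr (M i \<Otimes>\<^sub>M PiM I M) (PiM (insert i I) M) (\<lambda>(x, X). fun_upd X i x))"
    by (subst distr_pair_PiM_eq_PiM) (use M i in \<open>auto simp: ii\<close>)
  also have "\<dots> = (\<integral>\<^sup>+p. F (fun_upd (snd p) i (fst p)) \<partial>(M i \<Otimes>\<^sub>M PiM I M))"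
    by (subst nn_integral_distr) (auto simp: ii split_beta')
  finally have *: "(\<integral>\<^sup>+\<omega>. F \<omega> \<partial>PiM I M) = (\<integral>\<^sup>+p. F (fun_upd (snd p) i (fst p)) \<partial>(M i \<Otimes>\<^sub>M PiM I M))" .
  show "(\<integral>\<^sup>+\<omega>. F \<omega> \<partial>PiM I M) = (\<integral>\<^sup>+\<omega>. \<integral>\<^sup>+x. F (fun_upd \<omega> i x) \<partial>M i \<partial>PiM I M)"
    unfolding * by (subst PP.nn_integral_snd[symmetric]) auto
  show "(\<integral>\<^sup>+\<omega>. F \<omega> \<partial>PiM I M) = (\<integral>\<^sup>+x. \<integral>\<^sup>+\<omega>. F (fun_upd \<omega> i x) \<partial>PiM I M \<partial>M i)"
    unfolding * by (subst PI.nn_integral_fst[symmetric]) auto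
qed

lemma nn_integral_PiM_component:
  assumes M: "\<And>i. i \<in> I \<Longrightarrow> prob_space (M i)" and i: "i \<in> I"
    and F[measurable]: "F \<in> borel_measurable (M i)"
  shows "(\<integral>\<^sup>+\<omega>. F (\<omega> i) \<partial>PiM I M) = (\<integral>\<^sup>+x. F x \<partial>M i)"
proof -
  have "(\<integral>\<^sup>+x. F x \<partial>M i) = (\<integral>\<^sup>+x. F x \<partial>distr (PiM I M) (M i) (\<lambda>\<omega>. \<omega> i))"
    by (subst distr_PiM_component[OF M i]) auto
  also have "\<dots> = (\<integral>\<^sup>+\<omega>. F (\<omega> i) \<partial>PiM I M)"
    using i by (subst nn_integral_distr) auto
  finally show ?thesis ..
qed

section \<open>Fair coins, product kernels, and redrawing part of a factor\<close>

lemma sets_coin[simp, measurable_cong]: "sets coin = UNIV" and space_coin[simp]: "space coin = UNIV"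
  by (simp_all add: coin_def)

lemma prob_space_coin: "prob_space coin"
  unfolding coin_def by (rule prob_space_measure_pmf)

lemma emeasure_coin_UNIV[simp]: "emeasure coin UNIV = 1"
  using prob_space.emeasure_space_1[OF prob_space_coin] by simp

text \<open>Rectangles form an intersection-stable generator, and on a rectangle the product measure
  is a finite product of functions measurable in the parameter. The supersample is drawn from a
  product whose factors depend on the random client distributions, so this is what makes its law a
  kernel.\<close>

lemma measurable_PiM_kernel:
  assumes I: "finite I" and k: "\<And>i. i \<in> I \<Longrightarrow> k i \<in> N \<rightarrow>\<^sub>M prob_algebra (L i)"
  shows "(\<lambda>x. PiM I (\<lambda>i. k i x)) \<in> N \<rightarrow>\<^sub>M prob_algebra (PiM I L)"
proof (rule measurable_prob_algebra_generated[OF sets_PiM Int_stable_prod_algebra prod_algebra_sets_into_space])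
  fix x assume x: "x \<in> space N"
  have kx: "prob_space (k i x)" "sets (k i x) = sets (L i)" if "i \<in> I" for i
    using measurable_space[OF k[OF that] x] by (auto simp: space_prob_algebra)
  show "prob_space (PiM I (\<lambda>i. k i x))"
    by (rule prob_space_PiM) (use kx in auto)
  show "sets (PiM I (\<lambda>i. k i x)) = sets (PiM I L)"
    by (rule sets_PiM_cong) (use kx in auto)
next
  fix E assume "E \<in> prod_algebra I L"
  then obtain X where X: "E = (\<Pi>\<^sub>E i\<in>I. X i)" "\<And>i. i \<in> I \<Longrightarrow> X i \<in> sets (L i)"
    unfolding prod_algebra_eq_finite[OF I] by auto
  have "emeasure (PiM I (\<lambda>i. k i x)) E = (\<Prod>i\<in>I. emeasure (k i x) (X i))" if x: "x \<in> space N" for x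
  proof -
    have kx: "prob_space (k i x)" "sets (k i x) = sets (L i)" if "i \<in> I" for i
      using measurable_space[OF k[OF that] x] by (auto simp: space_prob_algebra)
    have "prod_emb I (\<lambda>i. k i x) I (Pi\<^sub>E I X) = Pi\<^sub>E I X"
      using X kx sets.sets_into_space[of "X _" "k _ x"] by (intro prod_emb_PiE_same_index) auto
    with emeasure_PiM_emb[of I "\<lambda>i. k i x" I X] I X kx show ?thesis by (simp add: X)
  qed
  moreover have "(\<lambda>x. \<Prod>i\<in>I. emeasure (k i x) (X i)) \<in> borel_measurable N"
    using X measurable_prob_algebraD[OF k]
    by (intro borel_measurable_prod_ennreal measurable_compose[OF _ measurable_emeasure_subprob_algebra]) auto
  ultimately show "(\<lambda>x. emeasure (PiM I (\<lambda>i. k i x)) E) \<in> borel_measurable N"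
    by (simp cong: measurable_cong)
qed

text \<open>Here a factor is itself a structured object, and \<open>u p y\<close> replaces only a
  piece of \<open>p\<close> by fresh noise \<open>y\<close>. Invariance of the factor under this
  partial replacement lifts to the product, so the lemma can be applied once for each level of a
  nested product. In the proof the factor is redrawn as a whole, then in part, and the first redraw
  is undone.\<close>

lemma nn_integral_PiM_resample_part:
  assumes M: "\<And>i. i \<in> I \<Longrightarrow> prob_space (M i)" and i: "i \<in> I" and N: "prob_space N"
    and u[measurable]: "(\<lambda>(p, y). u p y) \<in> M i \<Otimes>\<^sub>M N \<rightarrow>\<^sub>M M i"
    and H: "\<And>G. G \<in> borel_measurable (M i) \<Longrightarrow> (\<integral>\<^sup>+p. G p \<partial>M i) = (\<integral>\<^sup>+p. \<integral>\<^sup>+y. G (u p y) \<partial>N \<partial>M i)"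
    and F[measurable]: "F \<in> borel_measurable (PiM I M)"
  shows "(\<integral>\<^sup>+\<omega>. F \<omega> \<partial>PiM I M) = (\<integral>\<^sup>+\<omega>. \<integral>\<^sup>+y. F (fun_upd \<omega> i (u (\<omega> i) y)) \<partial>N \<partial>PiM I M)"
proof -
  interpret N: prob_space N by fact
  have ii: "insert i I = I" using i by auto
  have [measurable]: "(\<lambda>\<omega>. \<omega> i) \<in> PiM I M \<rightarrow>\<^sub>M M i" using i by simp
  have upd: "f \<in> L \<rightarrow>\<^sub>M PiM I M \<Longrightarrow> g \<in> L \<rightarrow>\<^sub>M M i \<Longrightarrow> (\<lambda>x. fun_upd (f x) i (g x)) \<in> L \<rightarrow>\<^sub>M PiM I M" for f g L
    by (rule measurable_fun_upd[where J=I]) (auto simp: ii)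
  have [measurable]: "(\<lambda>x. u (f x) (g x)) \<in> L \<rightarrow>\<^sub>M M i" 
    if "f \<in> L \<rightarrow>\<^sub>M M i" "g \<in> L \<rightarrow>\<^sub>M N" for f g L
    using measurable_compose[OF measurable_Pair[OF that] u] by simp
  have 1: "(\<lambda>(\<omega>, y). F (fun_upd \<omega> i (u (\<omega> i) y))) \<in> borel_measurable (PiM I M \<Otimes>\<^sub>M N)"
    unfolding split_beta' by (intro measurable_compose[OF upd F]) measurable
  have 2: "(\<lambda>p. F (fun_upd \<omega> i p)) \<in> borel_measurable (M i)" if "\<omega> \<in> space (PiM I M)" for \<omega>
    by (intro measurable_compose[OF upd F]) (use that in auto)
  have "(\<integral>\<^sup>+\<omega>. F \<omega> \<partial>PiM I M) = (\<integral>\<^sup>+\<omega>. \<integral>\<^sup>+p. F (fun_upd \<omega> i p) \<partial>M i \<partial>PiM I M)"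
    by (rule nn_integral_PiM_resample(1)[OF M i F])
  also have "\<dots> = (\<integral>\<^sup>+\<omega>. \<integral>\<^sup>+p. \<integral>\<^sup>+y. F (fun_upd \<omega> i (u p y)) \<partial>N \<partial>M i \<partial>PiM I M)"
    by (intro nn_integral_cong H 2)
  also have "\<dots> = (\<integral>\<^sup>+\<omega>. \<integral>\<^sup>+y. F (fun_upd \<omega> i (u (\<omega> i) y)) \<partial>N \<partial>PiM I M)"
    by (subst nn_integral_PiM_resample(1)[OF M i]) (use N.borel_measurable_nn_integral[OF 1] in auto)
  finally show ?thesis .
qed

text \<open>A random Boolean index splits into two fixed ones, so evaluation at the selected client
  or point stays measurable.\<close>

lemma measurable_bool_apply:
  assumes [measurable]: "f \<in> N \<rightarrow>\<^sub>M PiM UNIV (\<lambda>_::bool. M)" "Measurable.pred N b"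
  shows "(\<lambda>x. f x (b x)) \<in> N \<rightarrow>\<^sub>M M"
proof -
  have "(\<lambda>x. if b x then f x True else f x False) \<in> N \<rightarrow>\<^sub>M M" by measurable
  also have "(\<lambda>x. if b x then f x True else f x False) = (\<lambda>x. f x (b x))" 
    by (rule ext) auto
  finally show ?thesis .
qed

section \<open>The law of a superclient\<close>

lemma sc_simps[simp]: "sc_mu (m, z, v, u) = m" "sc_Z (m, z, v, u) = z" "sc_V (m, z, v, u) = v" "sc_U (m, z, v, u) = u"
  by (simp_all add: sc_mu_def sc_Z_def sc_V_def sc_U_def)

definition bits_law :: "nat \<Rightarrow> (bool \<Rightarrow> nat \<Rightarrow> bool) measure" where
  "bits_law n = PiM UNIV (\<lambda>_::bool. PiM {..<n} (\<lambda>_. coin))"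

definition ss_law :: "'z measure \<Rightarrow> nat \<Rightarrow> (nat \<Rightarrow> bool \<Rightarrow> 'z) measure" where
  "ss_law \<mu> n = PiM {..<n} (\<lambda>_. PiM UNIV (\<lambda>_::bool. \<mu>))"

definition training_row :: "nat \<Rightarrow> 'z superclient \<Rightarrow> nat \<Rightarrow> 'z" where
  "training_row n x = (\<lambda>j\<in>{..<n}. sc_Z x (sc_V x) j (sc_U x (sc_V x) j))"

lemma prob_space_bits_law: "prob_space (bits_law n)"
  unfolding bits_law_def by (intro prob_space_PiM prob_space_coin)

lemma sc_space_eq: "sc_space MZ n = PiM UNIV (\<lambda>_::bool. prob_algebra MZ) \<Otimes>\<^sub>M (PiM UNIV (\<lambda>_::bool. ss_space MZ n) \<Otimes>\<^sub>M
       (coin \<Otimes>\<^sub>M bits_law n))"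
  by (simp add: sc_space_def bits_law_def)

lemma measurable_sc_mu[measurable]: "sc_mu \<in> sc_space MZ n \<rightarrow>\<^sub>M PiM UNIV (\<lambda>_::bool. prob_algebra MZ)"
  and measurable_sc_Z[measurable]: "sc_Z \<in> sc_space MZ n \<rightarrow>\<^sub>M PiM UNIV (\<lambda>_::bool. ss_space MZ n)"
  and measurable_sc_V'[measurable]: "sc_V \<in> sc_space MZ n \<rightarrow>\<^sub>M coin"
  and measurable_sc_U[measurable]: "sc_U \<in> sc_space MZ n \<rightarrow>\<^sub>M bits_law n"
  unfolding sc_mu_def[abs_def] sc_Z_def[abs_def] sc_V_def[abs_def] sc_U_def[abs_def] sc_space_eq by measurable

lemma measurable_sc_tuple:
  assumes "f \<in> N \<rightarrow>\<^sub>M PiM UNIV (\<lambda>_::bool. prob_algebra MZ)" "g \<in> N \<rightarrow>\<^sub>M PiM UNIV (\<lambda>_::bool. ss_space MZ n)"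
    "h \<in> N \<rightarrow>\<^sub>M coin" "k \<in> N \<rightarrow>\<^sub>M bits_law n"
  shows "(\<lambda>x. (f x, g x, h x, k x)) \<in> N \<rightarrow>\<^sub>M sc_space MZ n"
  using assms unfolding sc_space_eq by (intro measurable_Pair)

lemma measurable_coin_eq: "measurable N coin = measurable N (count_space UNIV)"
  by (rule measurable_cong_sets) auto

lemma measurable_sc_V[measurable]: "sc_V \<in> sc_space MZ n \<rightarrow>\<^sub>M count_space UNIV"
  using measurable_sc_V' unfolding measurable_coin_eq .

lemma measurable_ss_apply:
  assumes j: "j < n" and f: "f \<in> N \<rightarrow>\<^sub>M PiM UNIV (\<lambda>_::bool. ss_space MZ n)"
    and b: "Measurable.pred N b" "Measurable.pred N c"
  shows "(\<lambda>x. f x (b x) j (c x)) \<in> N \<rightarrow>\<^sub>M MZ"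
proof (rule measurable_bool_apply[OF _ b(2)])
  have "(\<lambda>x. f x (b x)) \<in> N \<rightarrow>\<^sub>M ss_space MZ n" by (rule measurable_bool_apply[OF f b(1)])
  then show "(\<lambda>x. f x (b x) j) \<in> N \<rightarrow>\<^sub>M PiM UNIV (\<lambda>_. MZ)"
    unfolding ss_space_def by (rule measurable_compose) (use j in auto)
qed

lemma measurable_bits_apply:
  assumes j: "j < n" and f: "f \<in> N \<rightarrow>\<^sub>M bits_law n" and b: "Measurable.pred N b"
  shows "Measurable.pred N (\<lambda>x. f x (b x) j)"
proof -
  have "(\<lambda>x. f x (b x)) \<in> N \<rightarrow>\<^sub>M PiM {..<n} (\<lambda>_. coin)" 
    using f unfolding bits_law_def by (rule measurable_bool_apply[OF _ b])
  then have "(\<lambda>x. f x (b x) j) \<in> N \<rightarrow>\<^sub>M coin"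
    by (rule measurable_compose) (use j in auto)
  then show ?thesis by (simp add: measurable_coin_eq)
qed

lemma measurable_training_row[measurable]: "training_row n \<in> sc_space MZ n \<rightarrow>\<^sub>M PiM {..<n} (\<lambda>_. MZ)"
  unfolding training_row_def[abs_def]
  by (rule measurable_restrict)
    (auto intro: measurable_ss_apply[OF _ measurable_sc_Z measurable_sc_V] 
      measurable_bits_apply[OF _ measurable_sc_U measurable_sc_V])

section \<open>Integration formulas for one superclient\<close>

locale superclient =
  fixes MZ :: "'z measure" and D :: "'z measure measure" and n :: nat
  assumes prob_D: "prob_space D" and sets_D: "sets D = sets (prob_algebra MZ)"
begin

abbreviation "client_pair \<equiv> PiM UNIV (\<lambda>_::bool. D)"
abbreviation "supersample m \<equiv> PiM UNIV (\<lambda>b::bool. ss_law (m b) n)"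
abbreviation "SC \<equiv> superclient_law MZ D n"

lemma measurable_D[measurable_cong]: "sets D = sets (prob_algebra MZ)"
  by (rule sets_D)

lemma sets_client_pair[measurable_cong]: "sets client_pair = sets (PiM UNIV (\<lambda>_::bool. prob_algebra MZ))"
  by (rule sets_PiM_cong) (auto simp: sets_D)

lemma prob_client_pair: "prob_space client_pair"
  by (intro prob_space_PiM prob_D)

lemma space_client_pair: "m \<in> space client_pair \<Longrightarrow> m b \<in> space (prob_algebra MZ)"
  using sets_eq_imp_space_eq[OF sets_D] by (auto simp: space_PiM)

lemma measurable_ss_law[measurable]: "(\<lambda>\<mu>. ss_law \<mu> n) \<in> prob_algebra MZ \<rightarrow>\<^sub>M prob_algebra (ss_space MZ n)"
  unfolding ss_law_def ss_space_def
  by (intro measurable_PiM_kernel) auto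

lemma measurable_supersample[measurable]: 
  "supersample \<in> PiM UNIV (\<lambda>_::bool. prob_algebra MZ) \<rightarrow>\<^sub>M prob_algebra (PiM UNIV (\<lambda>_::bool. ss_space MZ n))"
  by (intro measurable_PiM_kernel measurable_compose[OF _ measurable_ss_law]) auto

lemma supersample: assumes "m \<in> space client_pair"
  shows "prob_space (supersample m)" "sets (supersample m) = sets (PiM UNIV (\<lambda>_::bool. ss_space MZ n))"
proof -
  have "supersample m \<in> space (prob_algebra (PiM UNIV (\<lambda>_::bool. ss_space MZ n)))"
    by (rule measurable_space[OF measurable_supersample]) 
      (use assms sets_eq_imp_space_eq[OF sets_client_pair] in auto)
  then show "prob_space (supersample m)" "sets (supersample m) = sets (PiM UNIV (\<lambda>_::bool. ss_space MZ n))"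
    by (auto simp: space_prob_algebra)
qed

text \<open>The part of a superclient that is independent of the bits; the client distributions must
  be drawn before the points.\<close>

definition "MZs = bind client_pair (\<lambda>m. distr (supersample m) 
   (PiM UNIV (\<lambda>_::bool. prob_algebra MZ) \<Otimes>\<^sub>M PiM UNIV (\<lambda>_::bool. ss_space MZ n)) (\<lambda>z. (m, z)))"

lemma SC_eq: "SC = distr (MZs \<Otimes>\<^sub>M (coin \<Otimes>\<^sub>M bits_law n)) (sc_space MZ n) (\<lambda>((m, z), r). (m, z, r))"
  unfolding superclient_law_def MZs_def bits_law_def ss_law_def ..

lemma measurable_MZs_kernel: "(\<lambda>m. distr (supersample m) 
   (PiM UNIV (\<lambda>_::bool. prob_algebra MZ) \<Otimes>\<^sub>M PiM UNIV (\<lambda>_::bool. ss_space MZ n)) (\<lambda>z. (m, z)))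
   \<in> client_pair \<rightarrow>\<^sub>M prob_algebra (PiM UNIV (\<lambda>_::bool. prob_algebra MZ) \<Otimes>\<^sub>M PiM UNIV (\<lambda>_::bool. ss_space MZ n))"
  by (intro measurable_distr_prob_space2[where M="PiM UNIV (\<lambda>_::bool. ss_space MZ n)"]) measurable

lemma MZs: "MZs \<in> space (prob_algebra (PiM UNIV (\<lambda>_::bool. prob_algebra MZ) \<Otimes>\<^sub>M PiM UNIV (\<lambda>_::bool. ss_space MZ n)))"
proof -
  have "client_pair \<in> space (prob_algebra client_pair)" 
    using prob_client_pair by (simp add: space_prob_algebra)
  then show ?thesis
    unfolding MZs_def using measurable_MZs_kernel
    by (simp add: space_prob_algebra prob_space_bind'[OF _ measurable_MZs_kernel] sets_bind'[OF _ measurable_MZs_kernel])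
qed

lemma prob_MZs: "prob_space MZs" and sets_MZs[measurable_cong]: 
  "sets MZs = sets (PiM UNIV (\<lambda>_::bool. prob_algebra MZ) \<Otimes>\<^sub>M PiM UNIV (\<lambda>_::bool. ss_space MZ n))"
  using MZs by (auto simp: space_prob_algebra)

lemma nn_integral_MZs:
  assumes F[measurable]: "F \<in> borel_measurable (PiM UNIV (\<lambda>_::bool. prob_algebra MZ) \<Otimes>\<^sub>M PiM UNIV (\<lambda>_::bool. ss_space MZ n))"
  shows "(\<integral>\<^sup>+x. F x \<partial>MZs) = (\<integral>\<^sup>+m. \<integral>\<^sup>+z. F (m, z) \<partial>supersample m \<partial>client_pair)"
  unfolding MZs_def
proof (subst nn_integral_bind[OF F measurable_prob_algebraD[OF measurable_MZs_kernel]], intro nn_integral_cong)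
  fix m assume m: "m \<in> space client_pair"
  note [measurable_cong] = supersample(2)[OF m]
  have "m \<in> space (PiM UNIV (\<lambda>_::bool. prob_algebra MZ))" 
    using m sets_eq_imp_space_eq[OF sets_client_pair] by simp
  then show "(\<integral>\<^sup>+ y. F y \<partial>distr (supersample m)
            (PiM UNIV (\<lambda>_::bool. prob_algebra MZ) \<Otimes>\<^sub>M PiM UNIV (\<lambda>_::bool. ss_space MZ n)) (Pair m)) =
         (\<integral>\<^sup>+ z. F (m, z) \<partial>supersample m)"
    by (subst nn_integral_distr) auto
qed

lemma measurable_reassoc: "(\<lambda>((m, z), r). (m, z, r)) \<in> MZs \<Otimes>\<^sub>M (coin \<Otimes>\<^sub>M bits_law n) \<rightarrow>\<^sub>M sc_space MZ n"
  unfolding sc_space_eq split_beta' by measurable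

lemma sets_SC[simp, measurable_cong]: "sets SC = sets (sc_space MZ n)"
  unfolding SC_eq by simp

lemma prob_SC: "prob_space SC"
  unfolding SC_eq using measurable_reassoc
  by (intro prob_space.prob_space_distr prob_space_pair prob_MZs prob_space_coin prob_space_bits_law)

text \<open>The bits are independent of distributions and points, so they may be integrated
  innermost or outermost, while \<open>m\<close> always precedes \<open>z\<close>. With the bits
  innermost they can be redrawn at fixed points; with the bits outermost the positions of the
  training points are fixed while the points are averaged.\<close>

lemma nn_integral_SC_mzvu:
  assumes F[measurable]: "F \<in> borel_measurable (sc_space MZ n)"
  shows "(\<integral>\<^sup>+x. F x \<partial>SC) = (\<integral>\<^sup>+m. \<integral>\<^sup>+z. \<integral>\<^sup>+v. \<integral>\<^sup>+u. F (m, z, v, u) \<partial>bits_law n \<partial>coin \<partial>supersample m \<partial>client_pair)"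
    and nn_integral_SC_vumz: "(\<integral>\<^sup>+x. F x \<partial>SC) = (\<integral>\<^sup>+v. \<integral>\<^sup>+u. \<integral>\<^sup>+m. \<integral>\<^sup>+z. F (m, z, v, u) \<partial>supersample m \<partial>client_pair \<partial>bits_law n \<partial>coin)"
proof -
  interpret B: prob_space MZs by (rule prob_MZs)
  interpret U: prob_space "bits_law n" by (rule prob_space_bits_law)
  interpret C: prob_space coin by (rule prob_space_coin)
  interpret CU: prob_space "coin \<Otimes>\<^sub>M bits_law n" by (intro prob_space_pair prob_space_coin prob_space_bits_law)
  interpret P: pair_sigma_finite MZs "coin \<Otimes>\<^sub>M bits_law n" ..
  have F1: "(\<lambda>p. F (fst (fst p), snd (fst p), snd p)) \<in> borel_measurable (MZs \<Otimes>\<^sub>M (coin \<Otimes>\<^sub>M bits_law n))"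
    using measurable_compose[OF measurable_reassoc F] by (simp add: split_beta')
  have *: "(\<integral>\<^sup>+x. F x \<partial>SC) = (\<integral>\<^sup>+p. F (fst (fst p), snd (fst p), snd p) \<partial>(MZs \<Otimes>\<^sub>M (coin \<Otimes>\<^sub>M bits_law n)))"
    unfolding SC_eq by (subst nn_integral_distr[OF measurable_reassoc]) (auto simp: split_beta')
  have "(\<integral>\<^sup>+x. F x \<partial>SC) = (\<integral>\<^sup>+b. \<integral>\<^sup>+r. F (fst b, snd b, r) \<partial>(coin \<Otimes>\<^sub>M bits_law n) \<partial>MZs)"
    unfolding * by (subst CU.nn_integral_fst[OF F1, symmetric]) simp
  also have "\<dots> = (\<integral>\<^sup>+b. \<integral>\<^sup>+v. \<integral>\<^sup>+u. F (fst b, snd b, v, u) \<partial>bits_law n \<partial>coin \<partial>MZs)"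
  proof (intro nn_integral_cong)
    fix b assume "b \<in> space MZs"
    then have b: "(\<lambda>r. F (fst b, snd b, r)) \<in> borel_measurable (coin \<Otimes>\<^sub>M bits_law n)"
      using measurable_compose[OF measurable_Pair1' F1] by simp
    show "(\<integral>\<^sup>+r. F (fst b, snd b, r) \<partial>(coin \<Otimes>\<^sub>M bits_law n)) = (\<integral>\<^sup>+v. \<integral>\<^sup>+u. F (fst b, snd b, v, u) \<partial>bits_law n \<partial>coin)"
      using U.nn_integral_fst[OF b] by simp
  qed
  also have "\<dots> = (\<integral>\<^sup>+m. \<integral>\<^sup>+z. \<integral>\<^sup>+v. \<integral>\<^sup>+u. F (m, z, v, u) \<partial>bits_law n \<partial>coin \<partial>supersample m \<partial>client_pair)"
  proof (subst nn_integral_MZs)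
    have "(\<lambda>((b, v), u). F (fst b, snd b, v, u)) \<in> borel_measurable (((PiM UNIV (\<lambda>_::bool. prob_algebra MZ) \<Otimes>\<^sub>M PiM UNIV (\<lambda>_::bool. ss_space MZ n)) \<Otimes>\<^sub>M coin) \<Otimes>\<^sub>M bits_law n)"
      unfolding split_beta' by (intro measurable_compose[OF _ F] measurable_sc_tuple) measurable
    then show "(\<lambda>b. \<integral>\<^sup>+v. \<integral>\<^sup>+u. F (fst b, snd b, v, u) \<partial>bits_law n \<partial>coin) \<in> borel_measurable
      (PiM UNIV (\<lambda>_::bool. prob_algebra MZ) \<Otimes>\<^sub>M PiM UNIV (\<lambda>_::bool. ss_space MZ n))"
      by (intro C.borel_measurable_nn_integral U.borel_measurable_nn_integral) (simp add: split_beta')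
  qed simp
  finally show "(\<integral>\<^sup>+x. F x \<partial>SC) = (\<integral>\<^sup>+m. \<integral>\<^sup>+z. \<integral>\<^sup>+v. \<integral>\<^sup>+u. F (m, z, v, u) \<partial>bits_law n \<partial>coin \<partial>supersample m \<partial>client_pair)" .
  have "(\<integral>\<^sup>+x. F x \<partial>SC) = (\<integral>\<^sup>+r. \<integral>\<^sup>+b. F (fst b, snd b, r) \<partial>MZs \<partial>(coin \<Otimes>\<^sub>M bits_law n))"
    unfolding * by (subst P.nn_integral_snd[symmetric]) (simp_all add: F1 split_beta')
  also have "\<dots> = (\<integral>\<^sup>+v. \<integral>\<^sup>+u. \<integral>\<^sup>+b. F (fst b, snd b, v, u) \<partial>MZs \<partial>bits_law n \<partial>coin)"
  proof (subst U.nn_integral_fst[symmetric])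
    show "(\<lambda>r. \<integral>\<^sup>+b. F (fst b, snd b, r) \<partial>MZs) \<in> borel_measurable (coin \<Otimes>\<^sub>M bits_law n)"
      using B.borel_measurable_nn_integral_fst[OF measurable_pair_swap[OF F1]] by (simp add: split_beta')
  qed simp
  also have "\<dots> = (\<integral>\<^sup>+v. \<integral>\<^sup>+u. \<integral>\<^sup>+m. \<integral>\<^sup>+z. F (m, z, v, u) \<partial>supersample m \<partial>client_pair \<partial>bits_law n \<partial>coin)"
  proof (intro nn_integral_cong)
    fix v u assume "v \<in> space coin" "u \<in> space (bits_law n)"
    then have "(\<lambda>b. F (fst b, snd b, v, u)) \<in> borel_measurable (PiM UNIV (\<lambda>_::bool. prob_algebra MZ) \<Otimes>\<^sub>M PiM UNIV (\<lambda>_::bool. ss_space MZ n))"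
      by (intro measurable_compose[OF _ F] measurable_sc_tuple) measurable
    from nn_integral_MZs[OF this]
    show "(\<integral>\<^sup>+b. F (fst b, snd b, v, u) \<partial>MZs) = (\<integral>\<^sup>+m. \<integral>\<^sup>+z. F (m, z, v, u) \<partial>supersample m \<partial>client_pair)"
      by simp
  qed
  finally show "(\<integral>\<^sup>+x. F x \<partial>SC) = (\<integral>\<^sup>+v. \<integral>\<^sup>+u. \<integral>\<^sup>+m. \<integral>\<^sup>+z. F (m, z, v, u) \<partial>supersample m \<partial>client_pair \<partial>bits_law n \<partial>coin)" .
qed

end

section \<open>Redrawing single bits and single points\<close>

lemma measurable_fun_upd_bool:
  assumes [measurable]: "f \<in> N \<rightarrow>\<^sub>M PiM UNIV (\<lambda>_::bool. M)" "Measurable.pred N b" "g \<in> N \<rightarrow>\<^sub>M M"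
  shows "(\<lambda>x. fun_upd (f x) (b x) (g x)) \<in> N \<rightarrow>\<^sub>M PiM UNIV (\<lambda>_::bool. M)"
proof (rule measurable_PiM_single')
  fix i :: bool
  have [measurable]: "(\<lambda>x. f x i) \<in> N \<rightarrow>\<^sub>M M" by measurable
  have [measurable]: "Measurable.pred N (\<lambda>x. i = b x)" by (cases i) auto
  show "(\<lambda>x. (fun_upd (f x) (b x) (g x)) i) \<in> N \<rightarrow>\<^sub>M M"
    unfolding fun_upd_def by measurable
next
  show "(\<lambda>x. fun_upd (f x) (b x) (g x)) \<in> space N \<rightarrow> (\<Pi>\<^sub>E i\<in>UNIV. space M)"
    using measurable_space[OF assms(1)] measurable_space[OF assms(3)] by (auto simp: space_PiM PiE_iff)
qed

lemma measurable_bits_upd: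
  assumes j: "j < n" and u: "u \<in> N \<rightarrow>\<^sub>M bits_law n" and b: "Measurable.pred N b" and c: "Measurable.pred N c"
  shows "(\<lambda>x. fun_upd (u x) (b x) (fun_upd (u x (b x)) j (c x))) \<in> N \<rightarrow>\<^sub>M bits_law n"
  unfolding bits_law_def
proof (rule measurable_fun_upd_bool[OF _ b])
  show u': "u \<in> N \<rightarrow>\<^sub>M PiM UNIV (\<lambda>_::bool. PiM {..<n} (\<lambda>_. coin))" using u by (simp add: bits_law_def)
  have "insert j {..<n} = {..<n}" using j by auto
  then show "(\<lambda>x. fun_upd (u x (b x)) j (c x)) \<in> N \<rightarrow>\<^sub>M PiM {..<n} (\<lambda>_. coin)"
    using c by (intro measurable_fun_upd[where J="{..<n}"] measurable_bool_apply[OF u' b]) (auto simp: measurable_coin_eq)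
qed

lemma nn_integral_bits_law_resample:
  assumes j: "j < n" and F: "F \<in> borel_measurable (bits_law n)"
  shows "(\<integral>\<^sup>+u. F u \<partial>bits_law n) = (\<integral>\<^sup>+u. \<integral>\<^sup>+c. F (fun_upd u b (fun_upd (u b) j c)) \<partial>coin \<partial>bits_law n)"
  unfolding bits_law_def
proof (rule nn_integral_PiM_resample_part)
  have ins: "insert j {..<n} = {..<n}" using j by auto
  show "(\<lambda>(p, y). fun_upd p j y) \<in> PiM {..<n} (\<lambda>_. coin) \<Otimes>\<^sub>M coin \<rightarrow>\<^sub>M PiM {..<n} (\<lambda>_. coin)"
    unfolding split_beta' by (intro measurable_fun_upd[where J="{..<n}"]) (auto simp: ins)
  show "(\<integral>\<^sup>+ p. G p \<partial>PiM {..<n} (\<lambda>_. coin)) = (\<integral>\<^sup>+ p. \<integral>\<^sup>+ y. G (fun_upd p j y) \<partial>coin \<partial>PiM {..<n} (\<lambda>_. coin))"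
    if "G \<in> borel_measurable (PiM {..<n} (\<lambda>_. coin))" for G
    by (rule nn_integral_PiM_resample(1)) (use j that prob_space_coin in auto)
qed (use F prob_space_coin in \<open>auto simp: bits_law_def intro!: prob_space_PiM\<close>)

lemma training_row_cong:
  assumes "\<And>j. j < n \<Longrightarrow> sc_Z x (sc_V x) j (sc_U x (sc_V x) j) = sc_Z y (sc_V y) j (sc_U y (sc_V y) j)"
  shows "training_row n x = training_row n y"
  using assms by (auto simp: training_row_def restrict_def fun_eq_iff)

context superclient begin

text \<open>A single point sits three product levels deep: client side \<open>b\<close>, position
  \<open>j\<close>, and copy \<open>c\<close>. The innermost level is an ordinary redraw from
  \<open>m b\<close>, and the invariance is lifted through the two outer levels.\<close>

lemma nn_integral_supersample_resample:
  assumes m: "m \<in> space client_pair" and j: "j < n" 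
    and G: "G \<in> borel_measurable (PiM UNIV (\<lambda>_::bool. ss_space MZ n))"
  shows "(\<integral>\<^sup>+z. G z \<partial>supersample m) = 
    (\<integral>\<^sup>+z. \<integral>\<^sup>+y. G (fun_upd z b (fun_upd (z b) j (fun_upd (z b j) c y))) \<partial>m b \<partial>supersample m)"
proof (rule nn_integral_PiM_resample_part)
  have mb: "prob_space (m b)" "sets (m b) = sets MZ" for b
    using space_client_pair[OF m, of b] by (auto simp: space_prob_algebra)
  have ins: "insert j {..<n} = {..<n}" using j by auto
  show ps: "prob_space (ss_law (m b) n)" for b
    unfolding ss_law_def by (intro prob_space_PiM mb)
  show "prob_space (m b)" by (rule mb)
  show "(\<lambda>(p, y). fun_upd p j (fun_upd (p j) c y)) \<in> ss_law (m b) n \<Otimes>\<^sub>M m b \<rightarrow>\<^sub>M ss_law (m b) n"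
    unfolding split_beta' ss_law_def using j
    by (intro measurable_fun_upd[where J="{..<n}"] measurable_fun_upd_bool
       measurable_compose[OF measurable_fst measurable_component_singleton[of j "{..<n}" "\<lambda>_. PiM UNIV (\<lambda>_::bool. m b)"]])
      (auto simp: ins)
  have H: "(\<integral>\<^sup>+p. G p \<partial>PiM UNIV (\<lambda>_::bool. m b)) = (\<integral>\<^sup>+p. \<integral>\<^sup>+y. G (fun_upd p c y) \<partial>m b \<partial>PiM UNIV (\<lambda>_::bool. m b))"
    if "G \<in> borel_measurable (PiM UNIV (\<lambda>_::bool. m b))" for G
    by (rule nn_integral_PiM_resample(1)) (use that mb in auto)
  show "(\<integral>\<^sup>+p. G p \<partial>ss_law (m b) n) = (\<integral>\<^sup>+p. \<integral>\<^sup>+y. G (fun_upd p j (fun_upd (p j) c y)) \<partial>m b \<partial>ss_law (m b) n)"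
    if "G \<in> borel_measurable (ss_law (m b) n)" for G
    unfolding ss_law_def
    by (rule nn_integral_PiM_resample_part[where u="\<lambda>p y. fun_upd p c y"])
      (use that j mb H in \<open>auto simp: ss_law_def split_beta' intro!: prob_space_PiM measurable_fun_upd_bool\<close>)
  show "G \<in> borel_measurable (supersample m)"
    using G supersample(2)[OF m] by (simp cong: measurable_cong_sets)
qed auto

lemma nn_integral_SC_bits:
  assumes [measurable]: "f \<in> borel_measurable (bits_law n)"
  shows "(\<integral>\<^sup>+x. f (sc_U x) \<partial>SC) = (\<integral>\<^sup>+u. f u \<partial>bits_law n)"
proof -
  interpret CP: prob_space client_pair by (rule prob_client_pair)
  interpret C: prob_space coin by (rule prob_space_coin)
  have "(\<integral>\<^sup>+x. f (sc_U x) \<partial>SC) = (\<integral>\<^sup>+m. \<integral>\<^sup>+z. (\<integral>\<^sup>+u. f u \<partial>bits_law n) \<partial>supersample m \<partial>client_pair)"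
    by (subst nn_integral_SC_mzvu) (auto simp: C.emeasure_space_1)
  also have "\<dots> = (\<integral>\<^sup>+m. (\<integral>\<^sup>+u. f u \<partial>bits_law n) \<partial>client_pair)"
    by (intro nn_integral_cong) (use supersample in \<open>auto simp: prob_space.emeasure_space_1\<close>)
  also have "\<dots> = (\<integral>\<^sup>+u. f u \<partial>bits_law n)"
    by (simp add: CP.emeasure_space_1)
  finally show ?thesis .
qed

lemma measurable_resample_V:
  assumes F: "F \<in> borel_measurable (sc_space MZ n)"
  shows "(\<lambda>x. \<integral>\<^sup>+v. F (sc_mu x, sc_Z x, v, sc_U x) \<partial>coin) \<in> borel_measurable (sc_space MZ n)"
proof -
  interpret C: prob_space coin by (rule prob_space_coin)
  show ?thesis
    by (intro C.borel_measurable_nn_integral) 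
      (unfold split_beta', intro measurable_compose[OF _ F] measurable_sc_tuple, measurable)
qed

lemma measurable_resample_bit:
  assumes F: "F \<in> borel_measurable (sc_space MZ n)" and j: "j < n"
  shows "(\<lambda>x. \<integral>\<^sup>+c. \<integral>\<^sup>+x'. F (sc_mu x, sc_Z x, sc_V x, 
     fun_upd (sc_U x') (sc_V x) (fun_upd (sc_U x' (sc_V x)) j c)) \<partial>SC \<partial>coin) \<in> borel_measurable (sc_space MZ n)"
proof -
  interpret C: prob_space coin by (rule prob_space_coin)
  interpret S: prob_space SC by (rule prob_SC)
  have "(\<lambda>((x, c), x'). F (sc_mu x, sc_Z x, sc_V x, fun_upd (sc_U x') (sc_V x) (fun_upd (sc_U x' (sc_V x)) j c)))
    \<in> borel_measurable ((sc_space MZ n \<Otimes>\<^sub>M coin) \<Otimes>\<^sub>M SC)"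
    unfolding split_beta' 
    by (intro measurable_compose[OF _ F] measurable_sc_tuple measurable_bits_upd[OF j]) 
      ((measurable; fail) | (simp add: measurable_coin_eq[symmetric], measurable; fail))+
  then show ?thesis
    by (intro C.borel_measurable_nn_integral S.borel_measurable_nn_integral) (simp add: split_beta')
qed

text \<open>The form of the right side is that of conditioning on the supersample and U: the outer
  integral fixes them and the inner one averages over V alone.\<close>

lemma nn_integral_SC_resample_V:
  assumes F: "F \<in> borel_measurable (sc_space MZ n)"
  shows "(\<integral>\<^sup>+x. F x \<partial>SC) = (\<integral>\<^sup>+x. \<integral>\<^sup>+v. F (sc_mu x, sc_Z x, v, sc_U x) \<partial>coin \<partial>SC)"
proof -
  interpret U: prob_space "bits_law n" by (rule prob_space_bits_law)
  interpret C: prob_space coin by (rule prob_space_coin)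
  interpret P: pair_sigma_finite coin "bits_law n" ..
  have "(\<integral>\<^sup>+x. \<integral>\<^sup>+v. F (sc_mu x, sc_Z x, v, sc_U x) \<partial>coin \<partial>SC)
      = (\<integral>\<^sup>+m. \<integral>\<^sup>+z. \<integral>\<^sup>+v. \<integral>\<^sup>+u. \<integral>\<^sup>+v'. F (m, z, v', u) \<partial>coin \<partial>bits_law n \<partial>coin \<partial>supersample m \<partial>client_pair)"
    by (subst nn_integral_SC_mzvu[OF measurable_resample_V[OF F]]) simp
  \<comment> \<open>The integrand no longer contains the original bit \<open>v\<close>, whose
    integral contributes the factor 1; the rest is an exchange of V and U.\<close>
  also have "\<dots> = (\<integral>\<^sup>+m. \<integral>\<^sup>+z. \<integral>\<^sup>+u. \<integral>\<^sup>+v'. F (m, z, v', u) \<partial>coin \<partial>bits_law n \<partial>supersample m \<partial>client_pair)"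
    by (simp add: C.emeasure_space_1)
  also have "\<dots> = (\<integral>\<^sup>+m. \<integral>\<^sup>+z. \<integral>\<^sup>+v. \<integral>\<^sup>+u. F (m, z, v, u) \<partial>bits_law n \<partial>coin \<partial>supersample m \<partial>client_pair)"
  proof (intro nn_integral_cong P.Fubini')
    fix m z assume m: "m \<in> space client_pair" and z: "z \<in> space (supersample m)"
    have "m \<in> space (PiM UNIV (\<lambda>_::bool. prob_algebra MZ))" 
      using m sets_eq_imp_space_eq[OF sets_client_pair] by simp
    moreover have "z \<in> space (PiM UNIV (\<lambda>_::bool. ss_space MZ n))"
      using z sets_eq_imp_space_eq[OF supersample(2)[OF m]] by simp
    ultimately show "(\<lambda>(v, u). F (m, z, v, u)) \<in> borel_measurable (coin \<Otimes>\<^sub>M bits_law n)"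
      unfolding split_beta' by (intro measurable_compose[OF _ F] measurable_sc_tuple) auto
  qed
  finally show ?thesis by (simp add: nn_integral_SC_mzvu[OF F])
qed

text \<open>Conditioning on the supersample, V and one bit \<open>c\<close> leaves all other bits of
  U random. They are read off an independent superclient \<open>x'\<close>, exactly as in
  \<open>Wlaw_U\<close>, so that \<open>x\<close> enters only through the quantities that are held
  fixed.\<close>

lemma nn_integral_SC_resample_bit:
  assumes F: "F \<in> borel_measurable (sc_space MZ n)" and j: "j < n"
  shows "(\<integral>\<^sup>+x. F x \<partial>SC) = (\<integral>\<^sup>+x. \<integral>\<^sup>+c. \<integral>\<^sup>+x'. F (sc_mu x, sc_Z x, sc_V x, 
     fun_upd (sc_U x') (sc_V x) (fun_upd (sc_U x' (sc_V x)) j c)) \<partial>SC \<partial>coin \<partial>SC)"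
proof -
  interpret U: prob_space "bits_law n" by (rule prob_space_bits_law)
  interpret C: prob_space coin by (rule prob_space_coin)
  interpret P: pair_sigma_finite coin "bits_law n" ..
  have "(\<integral>\<^sup>+x. \<integral>\<^sup>+c. \<integral>\<^sup>+x'. F (sc_mu x, sc_Z x, sc_V x, 
     fun_upd (sc_U x') (sc_V x) (fun_upd (sc_U x' (sc_V x)) j c)) \<partial>SC \<partial>coin \<partial>SC)
      = (\<integral>\<^sup>+m. \<integral>\<^sup>+z. \<integral>\<^sup>+v. \<integral>\<^sup>+u'. \<integral>\<^sup>+c. \<integral>\<^sup>+x'. F (m, z, v, fun_upd (sc_U x') v (fun_upd (sc_U x' v) j c))
         \<partial>SC \<partial>coin \<partial>bits_law n \<partial>coin \<partial>supersample m \<partial>client_pair)"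
    by (subst nn_integral_SC_mzvu[OF measurable_resample_bit[OF F j]]) simp
  also have "\<dots> = (\<integral>\<^sup>+m. \<integral>\<^sup>+z. \<integral>\<^sup>+v. \<integral>\<^sup>+u. F (m, z, v, u) \<partial>bits_law n \<partial>coin \<partial>supersample m \<partial>client_pair)"
  proof (rule nn_integral_cong, rule nn_integral_cong, rule nn_integral_cong)
    fix m z v assume m: "m \<in> space client_pair" and z: "z \<in> space (supersample m)"
    have m': "m \<in> space (PiM UNIV (\<lambda>_::bool. prob_algebra MZ))" 
      using m sets_eq_imp_space_eq[OF sets_client_pair] by simp
    have z': "z \<in> space (PiM UNIV (\<lambda>_::bool. ss_space MZ n))"
      using z sets_eq_imp_space_eq[OF supersample(2)[OF m]] by simp
    have 1: "(\<lambda>u. F (m, z, v, u)) \<in> borel_measurable (bits_law n)"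
      by (intro measurable_compose[OF _ F] measurable_sc_tuple) (use m' z' in auto)
    have 2: "(\<lambda>p. fun_upd (fst p) v (fun_upd (fst p v) j (snd p))) \<in> bits_law n \<Otimes>\<^sub>M coin \<rightarrow>\<^sub>M bits_law n"
      by (rule measurable_bits_upd[OF j]) (auto simp: measurable_coin_eq[symmetric])
    have 3: "(\<lambda>(c, u). F (m, z, v, fun_upd u v (fun_upd (u v) j c))) \<in> borel_measurable (coin \<Otimes>\<^sub>M bits_law n)"
      using measurable_compose[OF measurable_compose[OF measurable_pair_swap' 2] 1] by (simp add: split_beta')
    \<comment> \<open>The bits \<open>u'\<close> of the outer superclient have been replaced
      throughout, so their integral is trivial.\<close>
    have "(\<integral>\<^sup>+u'. \<integral>\<^sup>+c. \<integral>\<^sup>+x'. F (m, z, v, fun_upd (sc_U x') v (fun_upd (sc_U x' v) j c)) \<partial>SC \<partial>coin \<partial>bits_law n)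
      = (\<integral>\<^sup>+c. \<integral>\<^sup>+x'. F (m, z, v, fun_upd (sc_U x') v (fun_upd (sc_U x' v) j c)) \<partial>SC \<partial>coin)"
      by (simp add: U.emeasure_space_1)
    also have "\<dots> = (\<integral>\<^sup>+c. \<integral>\<^sup>+u. F (m, z, v, fun_upd u v (fun_upd (u v) j c)) \<partial>bits_law n \<partial>coin)"
    proof (intro nn_integral_cong nn_integral_SC_bits)
      fix c assume "c \<in> space coin"
      show "(\<lambda>u. F (m, z, v, fun_upd u v (fun_upd (u v) j c))) \<in> borel_measurable (bits_law n)"
        using measurable_compose[OF measurable_Pair1'[of c coin "bits_law n"] 3] by simp
    qed
    also have "\<dots> = (\<integral>\<^sup>+u. \<integral>\<^sup>+c. F (m, z, v, fun_upd u v (fun_upd (u v) j c)) \<partial>coin \<partial>bits_law n)"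
      by (rule P.Fubini'[OF 3, symmetric])
    also have "\<dots> = (\<integral>\<^sup>+u. F (m, z, v, u) \<partial>bits_law n)"
      by (rule nn_integral_bits_law_resample[OF j 1, symmetric])
    finally show "(\<integral>\<^sup>+u'. \<integral>\<^sup>+c. \<integral>\<^sup>+x'. F (m, z, v, fun_upd (sc_U x') v (fun_upd (sc_U x' v) j c)) \<partial>SC \<partial>coin \<partial>bits_law n)
      = (\<integral>\<^sup>+u. F (m, z, v, u) \<partial>bits_law n)" .
  qed
  finally show ?thesis by (simp add: nn_integral_SC_mzvu[OF F])
qed

end

section \<open>Ghost points\<close>

context superclient begin

lemma measurable_sc_mu_apply:
  assumes "B \<in> sc_space MZ n \<rightarrow>\<^sub>M count_space UNIV"
  shows "(\<lambda>x. sc_mu x (B x)) \<in> sc_space MZ n \<rightarrow>\<^sub>M prob_algebra MZ"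
  by (rule measurable_bool_apply[OF measurable_sc_mu assms])

text \<open>\<open>B\<close> chooses a client side from V: negation gives the unselected client, the
  identity the selected one. The training row reads only side V, and there only the copies marked by
  U. The point in question lies on the other side or carries the complementary bit, so redrawing it
  from its own law does not affect the row.\<close>

lemma nn_integral_SC_ghost:
  fixes B :: "bool \<Rightarrow> bool"
  assumes G[measurable]: "(\<lambda>(s, y). G s y) \<in> borel_measurable (PiM {..<n} (\<lambda>_. MZ) \<Otimes>\<^sub>M MZ)" and j: "j < n"
  shows "(\<integral>\<^sup>+x. G (training_row n x) (sc_Z x (B (sc_V x)) j (\<not> sc_U x (B (sc_V x)) j)) \<partial>SC)
    = (\<integral>\<^sup>+x. \<integral>\<^sup>+y. G (training_row n x) y \<partial>sc_mu x (B (sc_V x)) \<partial>SC)"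
proof -
  have BV: "Measurable.pred (sc_space MZ n) (\<lambda>x. B (sc_V x))"
    using measurable_compose[OF measurable_sc_V, of B "count_space UNIV"] by simp
  have UV: "Measurable.pred (sc_space MZ n) (\<lambda>x. \<not> sc_U x (B (sc_V x)) j)"
    using measurable_bits_apply[OF j measurable_sc_U BV] by measurable
  have F: "(\<lambda>x. G (training_row n x) (sc_Z x (B (sc_V x)) j (\<not> sc_U x (B (sc_V x)) j))) \<in> borel_measurable (sc_space MZ n)"
    using measurable_compose[OF measurable_Pair[OF measurable_training_row measurable_ss_apply[OF j measurable_sc_Z BV UV]] G]
    by simp
  have F': "(\<lambda>x. \<integral>\<^sup>+y. G (training_row n x) y \<partial>sc_mu x (B (sc_V x))) \<in> borel_measurable (sc_space MZ n)"
  proof (rule nn_integral_measurable_subprob_algebra2[OF _ measurable_prob_algebraD[OF measurable_sc_mu_apply[OF BV]]])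
    show "(\<lambda>(x, y). G (training_row n x) y) \<in> borel_measurable (sc_space MZ n \<Otimes>\<^sub>M MZ)"
      by measurable
  qed
  show ?thesis
    unfolding nn_integral_SC_vumz[OF F] nn_integral_SC_vumz[OF F']
  \<comment> \<open>Once the bits and the client distributions are fixed, the ghost point has a
    deterministic position and its law is the corresponding entry of \<open>m\<close>.\<close>
  proof (rule nn_integral_cong, rule nn_integral_cong, rule nn_integral_cong)
    fix v u m assume u: "u \<in> space (bits_law n)" and m: "m \<in> space client_pair"
    have m': "m \<in> space (PiM UNIV (\<lambda>_::bool. prob_algebra MZ))" 
      using m sets_eq_imp_space_eq[OF sets_client_pair] by simp
    let ?F = "\<lambda>z. G (training_row n (m, z, v, u)) (z (B v) j (\<not> u (B v) j))"
    have meas: "?F \<in> borel_measurable (PiM UNIV (\<lambda>_::bool. ss_space MZ n))"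
      using measurable_compose[OF measurable_sc_tuple F, of "\<lambda>_. m" "PiM UNIV (\<lambda>_::bool. ss_space MZ n)" "\<lambda>z. z" "\<lambda>_. v" "\<lambda>_. u"] m' u
      by simp
    have row: "training_row n (m, fun_upd z (B v) (fun_upd (z (B v)) j (fun_upd (z (B v) j) (\<not> u (B v) j) y)), v, u)
       = training_row n (m, z, v, u)" for z y
      by (rule training_row_cong) auto
    show "(\<integral>\<^sup>+ z. G (training_row n (m, z, v, u)) (sc_Z (m, z, v, u) (B (sc_V (m, z, v, u))) j (\<not> sc_U (m, z, v, u) (B (sc_V (m, z, v, u))) j)) \<partial>supersample m) =
       (\<integral>\<^sup>+ z. \<integral>\<^sup>+y. G (training_row n (m, z, v, u)) y \<partial>sc_mu (m, z, v, u) (B (sc_V (m, z, v, u))) \<partial>supersample m)"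
      using nn_integral_supersample_resample[OF m j meas, of "B v" "\<not> u (B v) j"] by (simp add: row)
  qed
qed

text \<open>The unselected client distribution is independent of the training row, but it cannot be
  redrawn directly because the law of the supersample depends on both entries of \<open>m\<close>.
  For fixed bits the row sees only side \<open>v\<close>; integrating the points out first leaves a
  function of \<open>m v\<close> and \<open>m (\<not> v)\<close>, two independent draws from
  \<open>D\<close>.\<close>

lemma nn_integral_SC_other_client:
  assumes G[measurable]: "(\<lambda>(s, y). G s y) \<in> borel_measurable (PiM {..<n} (\<lambda>_. MZ) \<Otimes>\<^sub>M MZ)"
  shows "(\<integral>\<^sup>+x. \<integral>\<^sup>+y. G (training_row n x) y \<partial>sc_mu x (\<not> sc_V x) \<partial>SC)
    = (\<integral>\<^sup>+x. \<integral>\<^sup>+\<mu>. \<integral>\<^sup>+y. G (training_row n x) y \<partial>\<mu> \<partial>D \<partial>SC)"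
proof -
  interpret D: prob_space D by (rule prob_D)
  have BV: "Measurable.pred (sc_space MZ n) (\<lambda>x. \<not> sc_V x)" by measurable
  have F: "(\<lambda>x. \<integral>\<^sup>+y. G (training_row n x) y \<partial>sc_mu x (\<not> sc_V x)) \<in> borel_measurable (sc_space MZ n)"
  proof (rule nn_integral_measurable_subprob_algebra2[OF _ measurable_prob_algebraD[OF measurable_sc_mu_apply[OF BV]]])
    show "(\<lambda>(x, y). G (training_row n x) y) \<in> borel_measurable (sc_space MZ n \<Otimes>\<^sub>M MZ)"
      by measurable
  qed
  have id: "(\<lambda>\<mu>. \<mu>) \<in> D \<rightarrow>\<^sub>M prob_algebra MZ" by measurable
  have H: "(\<lambda>(s, \<mu>). \<integral>\<^sup>+y. G s y \<partial>\<mu>) \<in> borel_measurable (PiM {..<n} (\<lambda>_. MZ) \<Otimes>\<^sub>M D)"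
    unfolding split_beta'
    by (rule nn_integral_measurable_subprob_algebra2[OF _ measurable_prob_algebraD[OF measurable_compose[OF measurable_snd id]]])
      measurable
  have F': "(\<lambda>x. \<integral>\<^sup>+\<mu>. \<integral>\<^sup>+y. G (training_row n x) y \<partial>\<mu> \<partial>D) \<in> borel_measurable (sc_space MZ n)"
    using measurable_compose[OF measurable_training_row D.borel_measurable_nn_integral[OF H]] .
  show ?thesis
    unfolding nn_integral_SC_vumz[OF F] nn_integral_SC_vumz[OF F']
  proof (rule nn_integral_cong, rule nn_integral_cong)
    fix v u assume u: "u \<in> space (bits_law n)"
    define r where "r s = (\<lambda>j\<in>{..<n}. s j (u v j))" for s :: "nat \<Rightarrow> bool \<Rightarrow> 'z"
    have row: "training_row n (m, z, v, u) = r (z v)" for m z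
      by (simp add: training_row_def r_def)
    have r[measurable]: "r \<in> ss_space MZ n \<rightarrow>\<^sub>M PiM {..<n} (\<lambda>_. MZ)"
      unfolding r_def[abs_def] ss_space_def
    proof (rule measurable_restrict)
      fix j assume "j \<in> {..<n}"
      then show "(\<lambda>s. s j (u v j)) \<in> PiM {..<n} (\<lambda>_. PiM UNIV (\<lambda>_::bool. MZ)) \<rightarrow>\<^sub>M MZ"
        by (intro measurable_compose[OF measurable_component_singleton[of j "{..<n}" "\<lambda>_. PiM UNIV (\<lambda>_::bool. MZ)"]]) auto
    qed
    \<comment> \<open>\<open>\<mu>0\<close> is the law behind the training row and
      \<open>\<mu>\<close> the law of the test point; separating them is what permits the redraw of
      the second alone.\<close>
    define k where "k \<mu>0 \<mu> = (\<integral>\<^sup>+s. \<integral>\<^sup>+y. G (r s) y \<partial>\<mu> \<partial>ss_law \<mu>0 n)" for \<mu>0 \<mu>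
    have Hr: "(\<lambda>(s, \<mu>). \<integral>\<^sup>+y. G (r s) y \<partial>\<mu>) \<in> borel_measurable (ss_space MZ n \<Otimes>\<^sub>M D)"
      using measurable_compose[OF measurable_Pair[OF measurable_compose[OF measurable_fst r] measurable_snd] H]
      by (simp add: split_beta')
    have k: "(\<lambda>p. k (fst p) (snd p)) \<in> borel_measurable (D \<Otimes>\<^sub>M D)"
      unfolding k_def
    proof (rule nn_integral_measurable_subprob_algebra2[OF _ measurable_prob_algebraD[OF measurable_compose[OF measurable_compose[OF measurable_fst id] measurable_ss_law]]])
      show "(\<lambda>(p, s). \<integral>\<^sup>+y. G (r s) y \<partial>snd p) \<in> borel_measurable ((D \<Otimes>\<^sub>M D) \<Otimes>\<^sub>M ss_space MZ n)"
        using measurable_compose[OF measurable_Pair[OF measurable_snd measurable_compose[OF measurable_fst measurable_snd]] Hr]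
        by (simp add: split_beta')
    qed
    have kk: "(\<lambda>m. k (m v) (m (\<not> v))) \<in> borel_measurable client_pair"
      using measurable_compose[OF _ k, of "\<lambda>m. (m v, m (\<not> v))" client_pair] by simp
    have comp: "(\<integral>\<^sup>+z. f (z v) \<partial>supersample m) = (\<integral>\<^sup>+s. f s \<partial>ss_law (m v) n)"
      if m: "m \<in> space client_pair" and f: "f \<in> borel_measurable (ss_space MZ n)" for f m
    proof (rule nn_integral_PiM_component)
      have mb: "prob_space (m b)" "sets (m b) = sets MZ" for b
        using space_client_pair[OF m, of b] by (auto simp: space_prob_algebra)
      show "prob_space (ss_law (m b) n)" for b
        unfolding ss_law_def by (intro prob_space_PiM mb)
      have "sets (ss_law (m v) n) = sets (ss_space MZ n)"
        unfolding ss_law_def ss_space_def by (intro sets_PiM_cong mb refl)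
      then show "f \<in> borel_measurable (ss_law (m v) n)" using f by (simp cong: measurable_cong_sets)
    qed simp
    have "(\<integral>\<^sup>+m. \<integral>\<^sup>+z. \<integral>\<^sup>+y. G (r (z v)) y \<partial>m (\<not> v) \<partial>supersample m \<partial>client_pair) = (\<integral>\<^sup>+m. k (m v) (m (\<not> v)) \<partial>client_pair)"
    proof (rule nn_integral_cong)
      fix m assume m: "m \<in> space client_pair"
      have "m (\<not> v) \<in> space D" using m by (auto simp: space_PiM)
      then have "(\<lambda>s. \<integral>\<^sup>+y. G (r s) y \<partial>m (\<not> v)) \<in> borel_measurable (ss_space MZ n)"
        using measurable_compose[OF measurable_Pair2' Hr] by simp
      from comp[OF m this] show "(\<integral>\<^sup>+z. \<integral>\<^sup>+y. G (r (z v)) y \<partial>m (\<not> v) \<partial>supersample m) = k (m v) (m (\<not> v))"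
        by (simp add: k_def)
    qed
    \<comment> \<open>Only the coordinate \<open>\<not> v\<close> is redrawn, so \<open>m v\<close>,
      and with it the law of the row, is kept.\<close>
    also have "\<dots> = (\<integral>\<^sup>+m. \<integral>\<^sup>+\<mu>. k (m v) \<mu> \<partial>D \<partial>client_pair)"
      by (subst nn_integral_PiM_resample(1)[where i="\<not> v"]) (auto intro: prob_D kk)
    also have "\<dots> = (\<integral>\<^sup>+m. \<integral>\<^sup>+z. \<integral>\<^sup>+\<mu>. \<integral>\<^sup>+y. G (r (z v)) y \<partial>\<mu> \<partial>D \<partial>supersample m \<partial>client_pair)"
    proof (rule nn_integral_cong)
      fix m assume m: "m \<in> space client_pair"
      have mv: "prob_space (m v)" "sets (m v) = sets MZ"
        using space_client_pair[OF m, of v] by (auto simp: space_prob_algebra)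
      interpret L: prob_space "ss_law (m v) n"
        unfolding ss_law_def by (intro prob_space_PiM mv)
      have sL: "sets (ss_law (m v) n) = sets (ss_space MZ n)"
        unfolding ss_law_def ss_space_def by (intro sets_PiM_cong mv refl)
      interpret P: pair_sigma_finite "ss_law (m v) n" D ..
      have "(\<integral>\<^sup>+\<mu>. k (m v) \<mu> \<partial>D) = (\<integral>\<^sup>+s. \<integral>\<^sup>+\<mu>. \<integral>\<^sup>+y. G (r s) y \<partial>\<mu> \<partial>D \<partial>ss_law (m v) n)"
        unfolding k_def using Hr
        by (intro P.Fubini') (simp add: sL cong: measurable_cong_sets sets_pair_measure_cong)
      also have "\<dots> = (\<integral>\<^sup>+z. \<integral>\<^sup>+\<mu>. \<integral>\<^sup>+y. G (r (z v)) y \<partial>\<mu> \<partial>D \<partial>supersample m)"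
        by (rule comp[OF m, symmetric]) (rule D.borel_measurable_nn_integral[OF Hr])
      finally show "(\<integral>\<^sup>+\<mu>. k (m v) \<mu> \<partial>D) = (\<integral>\<^sup>+z. \<integral>\<^sup>+\<mu>. \<integral>\<^sup>+y. G (r (z v)) y \<partial>\<mu> \<partial>D \<partial>supersample m)" .
    qed
    finally show "(\<integral>\<^sup>+m. \<integral>\<^sup>+z. \<integral>\<^sup>+y. G (training_row n (m, z, v, u)) y \<partial>sc_mu (m, z, v, u) (\<not> sc_V (m, z, v, u)) \<partial>supersample m \<partial>client_pair)
      = (\<integral>\<^sup>+m. \<integral>\<^sup>+z. \<integral>\<^sup>+\<mu>. \<integral>\<^sup>+y. G (training_row n (m, z, v, u)) y \<partial>\<mu> \<partial>D \<partial>supersample m \<partial>client_pair)"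
      by (simp add: row)
  qed
qed

end

section \<open>Mutual information with a fair bit\<close>

lemma bounded_integral:
  fixes f :: "'a \<Rightarrow> real"
  assumes "prob_space M" and f[measurable]: "f \<in> borel_measurable M" 
    and b: "\<And>x. x \<in> space M \<Longrightarrow> 0 \<le> f x \<and> f x \<le> 1"
  shows "integrable M f" "ennreal (\<integral>x. f x \<partial>M) = (\<integral>\<^sup>+x. ennreal (f x) \<partial>M)" "0 \<le> (\<integral>x. f x \<partial>M) \<and> (\<integral>x. f x \<partial>M) \<le> 1"
proof -
  interpret prob_space M by fact
  show i: "integrable M f"
    by (rule integrable_const_bound[where B=1]) (use b in auto)
  show "ennreal (\<integral>x. f x \<partial>M) = (\<integral>\<^sup>+x. ennreal (f x) \<partial>M)"
    by (rule nn_integral_eq_integral[symmetric, OF i]) (use b in auto)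
  have "(\<integral>x. f x \<partial>M) \<le> (\<integral>x. 1 \<partial>M)" by (rule integral_mono[OF i]) (use b in auto)
  then show "0 \<le> (\<integral>x. f x \<partial>M) \<and> (\<integral>x. f x \<partial>M) \<le> 1"
    using b by (auto intro!: Bochner_Integration.integral_nonneg simp: prob_space)
qed

text \<open>The parameter is moved into the measure: the image of \<open>L x\<close> under pairing
  with \<open>x\<close> is a kernel, against which one fixed function is integrated.\<close>

lemma integral_measurable_kernel:
  fixes f :: "'a \<Rightarrow> 'b \<Rightarrow> real"
  assumes f[measurable]: "(\<lambda>(x, y). f x y) \<in> borel_measurable (M \<Otimes>\<^sub>M N)"
  assumes L[measurable]: "L \<in> M \<rightarrow>\<^sub>M subprob_algebra N"
  shows "(\<lambda>x. \<integral>y. f x y \<partial>L x) \<in> borel_measurable M"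
proof -
  note measurable_distr2[measurable]
  have "(\<lambda>x. integral\<^sup>L (distr (L x) (M \<Otimes>\<^sub>M N) (\<lambda>y. (x, y))) (\<lambda>(x, y). f x y)) \<in> borel_measurable M"
    by measurable
  then show ?thesis
    by (rule measurable_cong[THEN iffD1, rotated]) (simp add: integral_distr)
qed

lemma abs_integral_diff_le_nn_integral:
  fixes a b :: "'a \<Rightarrow> real"
  assumes M: "integrable M a" "integrable M b"
    and B: "\<And>x. x \<in> space M \<Longrightarrow> ennreal \<bar>a x - b x\<bar> \<le> B x"
  shows "ennreal \<bar>(\<integral>x. a x \<partial>M) - (\<integral>x. b x \<partial>M)\<bar> \<le> (\<integral>\<^sup>+x. B x \<partial>M)"
proof -
  have "\<bar>(\<integral>x. a x \<partial>M) - (\<integral>x. b x \<partial>M)\<bar> = \<bar>\<integral>x. a x - b x \<partial>M\<bar>"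
    using M by simp
  also have "\<dots> \<le> (\<integral>x. \<bar>a x - b x\<bar> \<partial>M)" by (rule integral_abs_bound)
  finally have "ennreal \<bar>(\<integral>x. a x \<partial>M) - (\<integral>x. b x \<partial>M)\<bar> \<le> ennreal (\<integral>x. \<bar>a x - b x\<bar> \<partial>M)"
    by (rule ennreal_leI)
  also have "\<dots> = (\<integral>\<^sup>+x. ennreal \<bar>a x - b x\<bar> \<partial>M)"
    using M by (subst nn_integral_eq_integral) auto
  also have "\<dots> \<le> (\<integral>\<^sup>+x. B x \<partial>M)"
    by (intro nn_integral_mono B)
  finally show ?thesis .
qed

lemma measurable_compose_bit:
  fixes g :: "'w \<Rightarrow> bool \<Rightarrow> real" and B :: "bool \<Rightarrow> bool"
  assumes g[measurable]: "\<And>b. (\<lambda>w. g w b) \<in> borel_measurable MW"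
  shows "(\<lambda>p. g (fst p) (B (snd p))) \<in> borel_measurable (MW \<Otimes>\<^sub>M coin)"
proof -
  have [measurable]: "Measurable.pred (MW \<Otimes>\<^sub>M coin) (\<lambda>p. B (snd p))"
    by (rule measurable_compose[OF measurable_snd]) (simp add: measurable_def)
  have "(\<lambda>p. if B (snd p) then g (fst p) True else g (fst p) False) \<in> borel_measurable (MW \<Otimes>\<^sub>M coin)"
    by measurable
  also have "(\<lambda>p. if B (snd p) then g (fst p) True else g (fst p) False) = (\<lambda>p. g (fst p) (B (snd p)))"
    by (rule ext) auto
  finally show ?thesis .
qed

text \<open>The common shape of \<open>joint_W_V\<close> and \<open>joint_W_U\<close>: a fair bit,
  followed by W drawn from a law chosen by the bit.\<close>

definition bit_joint :: "'w measure \<Rightarrow> (bool \<Rightarrow> 'w measure) \<Rightarrow> ('w \<times> bool) measure" where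
  "bit_joint MW \<kappa> = bind coin (\<lambda>c. distr (\<kappa> c) (MW \<Otimes>\<^sub>M coin) (\<lambda>w. (w, c)))"

context
  fixes MW :: "'w measure" and \<kappa> :: "bool \<Rightarrow> 'w measure"
  assumes \<kappa>: "\<And>c. \<kappa> c \<in> space (prob_algebra MW)"
begin

lemma measurable_bit_kernel: "(\<lambda>c. distr (\<kappa> c) (MW \<Otimes>\<^sub>M coin) (\<lambda>w. (w, c))) \<in> coin \<rightarrow>\<^sub>M prob_algebra (MW \<Otimes>\<^sub>M coin)"
proof (rule measurable_distr_prob_space2[where M=MW])
  show "(\<lambda>(c, w). (w, c)) \<in> coin \<Otimes>\<^sub>M MW \<rightarrow>\<^sub>M MW \<Otimes>\<^sub>M coin" by measurable
  show "\<kappa> \<in> coin \<rightarrow>\<^sub>M prob_algebra MW" using \<kappa> by (auto simp: measurable_def)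
qed

lemma coin_in_prob_algebra: "coin \<in> space (prob_algebra coin)"
  by (simp add: space_prob_algebra prob_space_coin)

lemma prob_bit_joint: "prob_space (bit_joint MW \<kappa>)"
  and sets_bit_joint: "sets (bit_joint MW \<kappa>) = sets (MW \<Otimes>\<^sub>M coin)"
  unfolding bit_joint_def
  by (rule prob_space_bind'[OF coin_in_prob_algebra measurable_bit_kernel])
     (rule sets_bind'[OF coin_in_prob_algebra measurable_bit_kernel])

lemma nn_integral_bit_joint:
  assumes f[measurable]: "f \<in> borel_measurable (MW \<Otimes>\<^sub>M coin)"
  shows "(\<integral>\<^sup>+p. f p \<partial>bit_joint MW \<kappa>) = (\<integral>\<^sup>+c. \<integral>\<^sup>+w. f (w, c) \<partial>\<kappa> c \<partial>coin)"
proof -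
  have [measurable_cong]: "sets (\<kappa> c) = sets MW" for c using \<kappa>[of c] by (simp add: space_prob_algebra)
  show ?thesis
    unfolding bit_joint_def
    by (subst nn_integral_bind[OF f measurable_prob_algebraD[OF measurable_bit_kernel]])
      (simp add: nn_integral_distr)
qed

text \<open>Each \<open>\<kappa> c\<close> has total mass 1, so drawing W does not bias the bit. The
  second marginal in \<open>mutual_info_ext\<close> is therefore the fair coin itself.\<close>

lemma distr_bit_joint_snd: "distr (bit_joint MW \<kappa>) coin snd = coin"
proof (rule measure_eqI)
  note [measurable_cong] = sets_bit_joint
  fix A :: "bool set" 
  have A: "A \<in> sets coin" by simp
  have [measurable]: "(indicator A :: bool \<Rightarrow> ennreal) \<in> borel_measurable coin" by (simp add: measurable_def)
  have "emeasure (distr (bit_joint MW \<kappa>) coin snd) A = (\<integral>\<^sup>+x. indicator A x \<partial>distr (bit_joint MW \<kappa>) coin snd)"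
    by simp
  also have "\<dots> = (\<integral>\<^sup>+p. indicator A (snd p) \<partial>bit_joint MW \<kappa>)"
    using A by (subst nn_integral_distr) auto
  also have "\<dots> = (\<integral>\<^sup>+c. \<integral>\<^sup>+w. indicator A c \<partial>\<kappa> c \<partial>coin)"
    by (subst nn_integral_bit_joint) auto
  also have "\<dots> = (\<integral>\<^sup>+c. indicator A c \<partial>coin)"
    using \<kappa> by (intro nn_integral_cong) (auto simp: space_prob_algebra prob_space.emeasure_space_1)
  finally show "emeasure (distr (bit_joint MW \<kappa>) coin snd) A = emeasure coin A" by simp
qed simp

text \<open>The antisymmetrisation of g in the bit has mean zero under the product of the marginals, because the bit is fair.\<close>
lemma bit_joint_mutual_info_bound:
  fixes g :: "'w \<Rightarrow> bool \<Rightarrow> real"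
  assumes g: "\<And>b. (\<lambda>w. g w b) \<in> borel_measurable MW" and b01: "\<And>w b. 0 \<le> g w b \<and> g w b \<le> 1"
  shows "ennreal \<bar>(\<integral>p. g (fst p) (\<not> snd p) \<partial>bit_joint MW \<kappa>) - (\<integral>p. g (fst p) (snd p) \<partial>bit_joint MW \<kappa>)\<bar>
    \<le> sqrt2_ext (mutual_info_ext MW coin (bit_joint MW \<kappa>))"
proof -
  let ?J = "bit_joint MW \<kappa>" let ?W = "distr ?J MW fst"
  interpret J: prob_space ?J by (rule prob_bit_joint)
  note [measurable_cong] = sets_bit_joint
  interpret W: prob_space ?W by (rule J.prob_space_distr) measurable
  interpret C: prob_space coin by (rule prob_space_coin)
  interpret P: pair_prob_space ?W coin ..
  note gb[measurable] = measurable_compose_bit[OF g]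
  let ?f = "\<lambda>p. g (fst p) (\<not> snd p) - g (fst p) (snd p)"
  have f[measurable]: "?f \<in> borel_measurable (MW \<Otimes>\<^sub>M coin)" using gb[of Not] gb[of "\<lambda>b. b"] by auto
  have f': "?f \<in> borel_measurable (?W \<Otimes>\<^sub>M coin)" by measurable
  have bnd: "\<bar>?f p\<bar> \<le> 1" for p
    using b01[of "fst p" "snd p"] b01[of "fst p" "\<not> snd p"] by (auto simp: abs_le_iff)
  have "integrable (?W \<Otimes>\<^sub>M coin) ?f"
    by (rule P.integrable_const_bound[where B=1]) (use bnd f' in auto)
  then have "(\<integral>p. ?f p \<partial>(?W \<Otimes>\<^sub>M coin)) = (\<integral>w. \<integral>c. ?f (w, c) \<partial>coin \<partial>?W)"
    by (rule P.integral_fst'[symmetric])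
  also have "\<dots> = 0"
    by (simp add: coin_def integral_pmf_of_set UNIV_bool)
  finally have cent: "(\<integral>p. ?f p \<partial>(?W \<Otimes>\<^sub>M coin)) = 0" .
  have "integrable ?J (\<lambda>p. g (fst p) (\<not> snd p))" "integrable ?J (\<lambda>p. g (fst p) (snd p))"
    using gb[of Not] gb[of "\<lambda>b. b"] b01 by (auto intro!: bounded_integral(1) prob_bit_joint cong: measurable_cong_sets simp: sets_bit_joint)
  then have "(\<integral>p. g (fst p) (\<not> snd p) \<partial>?J) - (\<integral>p. g (fst p) (snd p) \<partial>?J) = (\<integral>p. ?f p \<partial>?J)"
    by simp
  moreover have "ennreal \<bar>\<integral>p. ?f p \<partial>?J\<bar> \<le> sqrt2_ext (KL_ext (?W \<Otimes>\<^sub>M coin) ?J)"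
  proof (rule abs_expectation_le_sqrt2_KL_ext[OF _ _ _ f' bnd cent])
    show "sets ?J = sets (?W \<Otimes>\<^sub>M coin)" unfolding sets_bit_joint by (intro sets_pair_measure_cong) auto
  qed unfold_locales
  ultimately show ?thesis
    by (simp add: mutual_info_ext_def distr_bit_joint_snd)
qed

end

section \<open>The averaged algorithm\<close>

lemma train_sample_eq: "train_sample K n \<omega> = (\<lambda>i\<in>{..<K}. training_row n (\<omega> i))"
  unfolding train_sample_def training_row_def ..

lemma train_sample_upd:
  "i < K \<Longrightarrow> train_sample K n (fun_upd \<omega> i x) = fun_upd (train_sample K n \<omega>) i (training_row n x)"
  by (auto simp: train_sample_eq fun_eq_iff)

locale fl_setting = superclient MZ D n for MZ :: "'z measure" and D n +
  fixes MW :: "'w measure" and K :: nat and A :: "(nat \<Rightarrow> nat \<Rightarrow> 'z) \<Rightarrow> 'w measure"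
    and loss :: "'w \<Rightarrow> 'z \<Rightarrow> real"
  assumes K: "K \<ge> 1" and n: "n \<ge> 1"
    and A[measurable]: "A \<in> sample_space MZ K n \<rightarrow>\<^sub>M prob_algebra MW"
    and loss: "(\<lambda>(w, z). loss w z) \<in> borel_measurable (MW \<Otimes>\<^sub>M MZ)"
    and loss01: "\<And>w z. 0 \<le> loss w z \<and> loss w z \<le> 1"
begin

abbreviation "\<Omega> \<equiv> omega_law MZ D K n"
abbreviation "T \<equiv> train_sample K n"
abbreviation "row_space \<equiv> PiM {..<n} (\<lambda>_. MZ)"

lemma sets_\<Omega>: "sets \<Omega> = sets (PiM {..<K} (\<lambda>_. sc_space MZ n))"
  unfolding omega_law_def by (intro sets_PiM_cong) auto

declare sets_\<Omega>[measurable_cong]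

lemma prob_\<Omega>: "prob_space \<Omega>"
  unfolding omega_law_def by (intro prob_space_PiM prob_SC)

lemma measurable_client: "i < K \<Longrightarrow> (\<lambda>\<omega>. \<omega> i) \<in> \<Omega> \<rightarrow>\<^sub>M sc_space MZ n"
  by measurable

lemma space_client: "\<omega> \<in> space \<Omega> \<Longrightarrow> i < K \<Longrightarrow> \<omega> i \<in> space (sc_space MZ n)"
  using measurable_space[OF measurable_client] by blast

lemma measurable_T[measurable]: "T \<in> \<Omega> \<rightarrow>\<^sub>M sample_space MZ K n"
  unfolding train_sample_eq[abs_def] sample_space_def
  by (intro measurable_restrict measurable_compose[OF measurable_client measurable_training_row]) auto

lemma measurable_T_upd:
  assumes i: "i < K" and f: "f \<in> N \<rightarrow>\<^sub>M \<Omega>" and g: "g \<in> N \<rightarrow>\<^sub>M row_space"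
  shows "(\<lambda>x. fun_upd (T (f x)) i (g x)) \<in> N \<rightarrow>\<^sub>M sample_space MZ K n"
proof -
  have "insert i {..<K} = {..<K}" using i by auto
  then show ?thesis
    using measurable_compose[OF f measurable_T] g unfolding sample_space_def
    by (intro measurable_fun_upd[where J="{..<K}"]) auto
qed

text \<open>The law of W when client i trains on the row \<open>s\<close>. The row that \<Omega>
  produces for client i is overwritten, so only the other superclients are averaged.\<close>

definition row_kernel :: "nat \<Rightarrow> (nat \<Rightarrow> 'z) \<Rightarrow> 'w measure" where
  "row_kernel i s = bind \<Omega> (\<lambda>\<omega>. A (fun_upd (T \<omega>) i s))"

lemma \<Omega>_in_prob_algebra: "\<Omega> \<in> space (prob_algebra \<Omega>)"
  by (simp add: space_prob_algebra prob_\<Omega>)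

lemma measurable_row_kernel[measurable]: "i < K \<Longrightarrow> row_kernel i \<in> row_space \<rightarrow>\<^sub>M prob_algebra MW"
  unfolding row_kernel_def[abs_def]
  by (rule measurable_bind_prob_space2[where N=\<Omega>])
    (auto simp: split_beta' \<Omega>_in_prob_algebra intro!: measurable_compose[OF _ A] measurable_T_upd)

lemma row_kernel: "i < K \<Longrightarrow> s \<in> space row_space \<Longrightarrow> prob_space (row_kernel i s) \<and> sets (row_kernel i s) = sets MW"
  using measurable_space[OF measurable_row_kernel] by (auto simp: space_prob_algebra)

lemma nn_integral_row_kernel:
  assumes f: "f \<in> borel_measurable MW" and s: "s \<in> space row_space" and i: "i < K"
  shows "(\<integral>\<^sup>+w. f w \<partial>row_kernel i s) = (\<integral>\<^sup>+\<omega>. \<integral>\<^sup>+w. f w \<partial>A (fun_upd (T \<omega>) i s) \<partial>\<Omega>)"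
  unfolding row_kernel_def
  by (rule nn_integral_bind[OF f])
    (intro measurable_prob_algebraD measurable_compose[OF _ A] measurable_T_upd i measurable_const s measurable_ident_sets[OF refl])

lemma nn_integral_A_measurable:
  assumes i: "i < K" and \<phi>: "(\<lambda>(x, w). \<phi> x w) \<in> borel_measurable (sc_space MZ n \<Otimes>\<^sub>M MW)"
  shows "(\<lambda>\<omega>. \<integral>\<^sup>+w. \<phi> (\<omega> i) w \<partial>A (T \<omega>)) \<in> borel_measurable \<Omega>"
  by (rule nn_integral_measurable_subprob_algebra2[OF _ measurable_prob_algebraD[OF measurable_compose[OF measurable_T A]]])
    (use measurable_compose[OF measurable_Pair[OF measurable_compose[OF measurable_fst measurable_client[OF i]] measurable_snd] \<phi>] 
      in \<open>simp add: split_beta'\<close>)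

text \<open>The integrand looks at superclient i and W only, and the superclients are independent;
  taking superclient i to the outside leaves exactly the average that defines
  \<open>row_kernel\<close>.\<close>

lemma nn_integral_A_eq_row_kernel:
  assumes i: "i < K" and \<phi>: "(\<lambda>(x, w). \<phi> x w) \<in> borel_measurable (sc_space MZ n \<Otimes>\<^sub>M MW)"
  shows "(\<integral>\<^sup>+\<omega>. \<integral>\<^sup>+w. \<phi> (\<omega> i) w \<partial>A (T \<omega>) \<partial>\<Omega>) = (\<integral>\<^sup>+x. \<integral>\<^sup>+w. \<phi> x w \<partial>row_kernel i (training_row n x) \<partial>SC)"
proof -
  have "(\<integral>\<^sup>+\<omega>. \<integral>\<^sup>+w. \<phi> (\<omega> i) w \<partial>A (T \<omega>) \<partial>\<Omega>)
     = (\<integral>\<^sup>+x. \<integral>\<^sup>+\<omega>. \<integral>\<^sup>+w. \<phi> x w \<partial>A (fun_upd (T \<omega>) i (training_row n x)) \<partial>\<Omega> \<partial>SC)"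
    using nn_integral_PiM_resample(2)[of "{..<K}" "\<lambda>_. SC" i, OF _ _ nn_integral_A_measurable[OF i \<phi>, unfolded omega_law_def]] i prob_SC
    by (simp add: omega_law_def train_sample_upd)
  also have "\<dots> = (\<integral>\<^sup>+x. \<integral>\<^sup>+w. \<phi> x w \<partial>row_kernel i (training_row n x) \<partial>SC)"
  proof (rule nn_integral_cong)
    fix x assume "x \<in> space SC"
    then have x: "x \<in> space (sc_space MZ n)" using sets_eq_imp_space_eq[OF sets_SC] by simp
    then have "(\<lambda>w. \<phi> x w) \<in> borel_measurable MW" using measurable_compose[OF measurable_Pair1' \<phi>] by simp
    from nn_integral_row_kernel[OF this measurable_space[OF measurable_training_row x] i]
    show "(\<integral>\<^sup>+\<omega>. \<integral>\<^sup>+w. \<phi> x w \<partial>A (fun_upd (T \<omega>) i (training_row n x)) \<partial>\<Omega>) = (\<integral>\<^sup>+w. \<phi> x w \<partial>row_kernel i (training_row n x))" ..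
  qed
  finally show ?thesis .
qed

section \<open>Losses averaged over the hypothesis\<close>

definition loss_ennreal :: "'w \<Rightarrow> 'z \<Rightarrow> ennreal" where "loss_ennreal w z = ennreal (loss w z)"

lemma loss_ennreal: "(\<lambda>(w, z). loss_ennreal w z) \<in> borel_measurable (MW \<Otimes>\<^sub>M MZ)"
  unfolding loss_ennreal_def split_beta' using loss by (intro measurable_compose[OF _ measurable_ennreal]) (simp add: split_beta')

lemma measurable_loss_ennreal: "f \<in> N \<rightarrow>\<^sub>M MW \<Longrightarrow> g \<in> N \<rightarrow>\<^sub>M MZ \<Longrightarrow> (\<lambda>x. loss_ennreal (f x) (g x)) \<in> borel_measurable N"
  using measurable_compose[OF measurable_Pair loss_ennreal] by simp

lemma measurable_risk:
  assumes "f \<in> N \<rightarrow>\<^sub>M MW" "g \<in> N \<rightarrow>\<^sub>M prob_algebra MZ" 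
  shows "(\<lambda>x. \<integral>\<^sup>+z. loss_ennreal (f x) z \<partial>g x) \<in> borel_measurable N"
  by (rule nn_integral_measurable_subprob_algebra2[OF _ measurable_prob_algebraD[OF assms(2)]])
    (unfold split_beta', intro measurable_loss_ennreal measurable_compose[OF measurable_fst assms(1)] measurable_snd)

lemma id_D: "(\<lambda>\<mu>. \<mu>) \<in> D \<rightarrow>\<^sub>M prob_algebra MZ" by measurable

lemma measurable_risk_D:
  assumes "f \<in> N \<rightarrow>\<^sub>M MW"
  shows "(\<lambda>x. \<integral>\<^sup>+\<mu>. \<integral>\<^sup>+z. loss_ennreal (f x) z \<partial>\<mu> \<partial>D) \<in> borel_measurable N"
proof -
  interpret D: prob_space D by (rule prob_D)
  show ?thesis
    by (rule D.borel_measurable_nn_integral)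
     (unfold split_beta', intro measurable_risk measurable_compose[OF measurable_fst assms] measurable_compose[OF measurable_snd id_D])
qed

text \<open>After W has been integrated out, each of the three risks is the average of this one
  function at a suitable supersample point.\<close>

definition row_loss :: "nat \<Rightarrow> (nat \<Rightarrow> 'z) \<Rightarrow> 'z \<Rightarrow> ennreal" where
  "row_loss i s z = (\<integral>\<^sup>+w. loss_ennreal w z \<partial>row_kernel i s)"

lemma measurable_row_loss: "i < K \<Longrightarrow> f \<in> N \<rightarrow>\<^sub>M row_space \<Longrightarrow> g \<in> N \<rightarrow>\<^sub>M MZ \<Longrightarrow> (\<lambda>x. row_loss i (f x) (g x)) \<in> borel_measurable N"
  unfolding row_loss_def
  by (rule nn_integral_measurable_subprob_algebra2[OF _ measurable_prob_algebraD[OF measurable_compose[OF _ measurable_row_kernel]]])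
    (unfold split_beta', auto intro!: measurable_loss_ennreal)

lemma measurable_row_loss_pair: "i < K \<Longrightarrow> (\<lambda>(s, z). row_loss i s z) \<in> borel_measurable (row_space \<Otimes>\<^sub>M MZ)"
  unfolding split_beta' by (rule measurable_row_loss) auto

lemma row_kernel_risk_swap:
  assumes i: "i < K" and s: "s \<in> space row_space" and \<mu>: "\<mu> \<in> space (prob_algebra MZ)"
  shows "(\<integral>\<^sup>+w. \<integral>\<^sup>+z. loss_ennreal w z \<partial>\<mu> \<partial>row_kernel i s) = (\<integral>\<^sup>+z. row_loss i s z \<partial>\<mu>)"
proof -
  interpret row_kernel: prob_space "row_kernel i s" using row_kernel[OF i s] by simp
  interpret \<mu>: prob_space \<mu> using \<mu> by (simp add: space_prob_algebra)
  interpret P: pair_sigma_finite "row_kernel i s" \<mu> ..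
  show ?thesis unfolding row_loss_def
    using \<mu> row_kernel[OF i s] loss_ennreal
    by (intro P.Fubini'[symmetric]) (simp add: space_prob_algebra cong: measurable_cong_sets sets_pair_measure_cong)
qed

lemma row_kernel_risk_D_swap:
  assumes i: "i < K" and s: "s \<in> space row_space"
  shows "(\<integral>\<^sup>+w. \<integral>\<^sup>+\<mu>. \<integral>\<^sup>+z. loss_ennreal w z \<partial>\<mu> \<partial>D \<partial>row_kernel i s) = (\<integral>\<^sup>+\<mu>. \<integral>\<^sup>+z. row_loss i s z \<partial>\<mu> \<partial>D)"
proof -
  interpret row_kernel: prob_space "row_kernel i s" using row_kernel[OF i s] by simp
  interpret D: prob_space D by (rule prob_D)
  interpret P: pair_sigma_finite "row_kernel i s" D ..
  have "(\<lambda>(w, \<mu>). \<integral>\<^sup>+z. loss_ennreal w z \<partial>\<mu>) \<in> borel_measurable (MW \<Otimes>\<^sub>M D)"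
    unfolding split_beta' by (intro measurable_risk measurable_fst measurable_compose[OF measurable_snd id_D])
  then have "(\<integral>\<^sup>+w. \<integral>\<^sup>+\<mu>. \<integral>\<^sup>+z. loss_ennreal w z \<partial>\<mu> \<partial>D \<partial>row_kernel i s) = (\<integral>\<^sup>+\<mu>. \<integral>\<^sup>+w. \<integral>\<^sup>+z. loss_ennreal w z \<partial>\<mu> \<partial>row_kernel i s \<partial>D)"
    using row_kernel[OF i s]
    by (intro P.Fubini'[symmetric]) (simp cong: measurable_cong_sets sets_pair_measure_cong)
  also have "\<dots> = (\<integral>\<^sup>+\<mu>. \<integral>\<^sup>+z. row_loss i s z \<partial>\<mu> \<partial>D)"
    by (intro nn_integral_cong row_kernel_risk_swap i s) (use sets_eq_imp_space_eq[OF sets_D] in simp)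
  finally show ?thesis .
qed

section \<open>The three risks as integrals over one superclient\<close>

lemma space_SC: "space SC = space (sc_space MZ n)"
  by (rule sets_eq_imp_space_eq) simp

lemma space_row: "x \<in> space SC \<Longrightarrow> training_row n x \<in> space row_space"
  unfolding space_SC by (rule measurable_space[OF measurable_training_row])

text \<open>The left side involves neither i nor j, so any client and any position may represent it.
  The unselected client first turns the average over \<open>D\<close> into an average over its own
  distribution, and its ghost point then samples that distribution.\<close>

lemma population_risk_eq:
  assumes i: "i < K" and j: "j < n"
  shows "(\<integral>\<^sup>+\<omega>. \<integral>\<^sup>+w. \<integral>\<^sup>+\<mu>. \<integral>\<^sup>+z. loss_ennreal w z \<partial>\<mu> \<partial>D \<partial>A (T \<omega>) \<partial>\<Omega>)
    = (\<integral>\<^sup>+x. row_loss i (training_row n x) (sc_Z x (\<not> sc_V x) j (\<not> sc_U x (\<not> sc_V x) j)) \<partial>SC)"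
proof -
  have "(\<integral>\<^sup>+\<omega>. \<integral>\<^sup>+w. \<integral>\<^sup>+\<mu>. \<integral>\<^sup>+z. loss_ennreal w z \<partial>\<mu> \<partial>D \<partial>A (T \<omega>) \<partial>\<Omega>)
     = (\<integral>\<^sup>+x. \<integral>\<^sup>+w. \<integral>\<^sup>+\<mu>. \<integral>\<^sup>+z. loss_ennreal w z \<partial>\<mu> \<partial>D \<partial>row_kernel i (training_row n x) \<partial>SC)"
    by (rule nn_integral_A_eq_row_kernel[OF i]) (unfold split_beta', intro measurable_risk_D measurable_snd)
  also have "\<dots> = (\<integral>\<^sup>+x. \<integral>\<^sup>+\<mu>. \<integral>\<^sup>+z. row_loss i (training_row n x) z \<partial>\<mu> \<partial>D \<partial>SC)"
    by (intro nn_integral_cong row_kernel_risk_D_swap i space_row)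
  also have "\<dots> = (\<integral>\<^sup>+x. \<integral>\<^sup>+z. row_loss i (training_row n x) z \<partial>sc_mu x (\<not> sc_V x) \<partial>SC)"
    by (rule nn_integral_SC_other_client[OF measurable_row_loss_pair[OF i], symmetric])
  also have "\<dots> = (\<integral>\<^sup>+x. row_loss i (training_row n x) (sc_Z x (\<not> sc_V x) j (\<not> sc_U x (\<not> sc_V x) j)) \<partial>SC)"
    by (rule nn_integral_SC_ghost[OF measurable_row_loss_pair[OF i] j, symmetric])
  finally show ?thesis .
qed

lemma measurable_own_mu: "(\<lambda>x. sc_mu x (sc_V x)) \<in> sc_space MZ n \<rightarrow>\<^sub>M prob_algebra MZ"
  by (rule measurable_sc_mu_apply) measurable

text \<open>Again every position j is admissible. This freedom lets the same risk be compared with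
  the population risk at position 0 and with the empirical loss at any given training
  position.\<close>

lemma participation_risk_eq:
  assumes i: "i < K" and j: "j < n"
  shows "(\<integral>\<^sup>+\<omega>. \<integral>\<^sup>+w. \<integral>\<^sup>+z. loss_ennreal w z \<partial>sc_mu (\<omega> i) (sc_V (\<omega> i)) \<partial>A (T \<omega>) \<partial>\<Omega>)
    = (\<integral>\<^sup>+x. row_loss i (training_row n x) (sc_Z x (sc_V x) j (\<not> sc_U x (sc_V x) j)) \<partial>SC)"
proof -
  have "(\<integral>\<^sup>+\<omega>. \<integral>\<^sup>+w. \<integral>\<^sup>+z. loss_ennreal w z \<partial>sc_mu (\<omega> i) (sc_V (\<omega> i)) \<partial>A (T \<omega>) \<partial>\<Omega>)
     = (\<integral>\<^sup>+x. \<integral>\<^sup>+w. \<integral>\<^sup>+z. loss_ennreal w z \<partial>sc_mu x (sc_V x) \<partial>row_kernel i (training_row n x) \<partial>SC)"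
    by (rule nn_integral_A_eq_row_kernel[OF i, of "\<lambda>x w. \<integral>\<^sup>+z. loss_ennreal w z \<partial>sc_mu x (sc_V x)"]) 
      (unfold split_beta', intro measurable_risk measurable_snd measurable_compose[OF measurable_fst measurable_own_mu])
  also have "\<dots> = (\<integral>\<^sup>+x. \<integral>\<^sup>+z. row_loss i (training_row n x) z \<partial>sc_mu x (sc_V x) \<partial>SC)"
    using measurable_space[OF measurable_own_mu]
    by (intro nn_integral_cong row_kernel_risk_swap i space_row) (auto simp: space_SC)
  also have "\<dots> = (\<integral>\<^sup>+x. row_loss i (training_row n x) (sc_Z x (sc_V x) j (\<not> sc_U x (sc_V x) j)) \<partial>SC)"
    using nn_integral_SC_ghost[OF measurable_row_loss_pair[OF i] j, where B="\<lambda>b. b"] by simp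
  finally show ?thesis .
qed

lemma measurable_train_pt:
  assumes j: "j < n" shows "(\<lambda>x. sc_Z x (sc_V x) j (sc_U x (sc_V x) j)) \<in> sc_space MZ n \<rightarrow>\<^sub>M MZ"
  by (intro measurable_ss_apply[OF j measurable_sc_Z measurable_sc_V] measurable_bits_apply[OF j measurable_sc_U measurable_sc_V])

lemma empirical_risk_eq:
  assumes i: "i < K" and j: "j < n"
  shows "(\<integral>\<^sup>+\<omega>. \<integral>\<^sup>+w. loss_ennreal w (T \<omega> i j) \<partial>A (T \<omega>) \<partial>\<Omega>)
    = (\<integral>\<^sup>+x. row_loss i (training_row n x) (sc_Z x (sc_V x) j (sc_U x (sc_V x) j)) \<partial>SC)"
proof -
  have "(\<integral>\<^sup>+\<omega>. \<integral>\<^sup>+w. loss_ennreal w (T \<omega> i j) \<partial>A (T \<omega>) \<partial>\<Omega>) 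
    = (\<integral>\<^sup>+\<omega>. \<integral>\<^sup>+w. loss_ennreal w (sc_Z (\<omega> i) (sc_V (\<omega> i)) j (sc_U (\<omega> i) (sc_V (\<omega> i)) j)) \<partial>A (T \<omega>) \<partial>\<Omega>)"
    using i j by (simp add: train_sample_def)
  also have "\<dots> = (\<integral>\<^sup>+x. \<integral>\<^sup>+w. loss_ennreal w (sc_Z x (sc_V x) j (sc_U x (sc_V x) j)) \<partial>row_kernel i (training_row n x) \<partial>SC)"
    by (rule nn_integral_A_eq_row_kernel[OF i, of "\<lambda>x w. loss_ennreal w (sc_Z x (sc_V x) j (sc_U x (sc_V x) j))"]) 
      (unfold split_beta', intro measurable_loss_ennreal measurable_snd measurable_compose[OF measurable_fst measurable_train_pt[OF j]])
  finally show ?thesis by (simp add: row_loss_def)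
qed

end

section \<open>Risks as expectations\<close>

context fl_setting begin

lemma measurable_loss: "f \<in> N \<rightarrow>\<^sub>M MW \<Longrightarrow> g \<in> N \<rightarrow>\<^sub>M MZ \<Longrightarrow> (\<lambda>x. loss (f x) (g x)) \<in> borel_measurable N"
  using measurable_compose[OF measurable_Pair loss] by simp

lemma A_T: "\<omega> \<in> space \<Omega> \<Longrightarrow> prob_space (A (T \<omega>)) \<and> sets (A (T \<omega>)) = sets MW"
  using measurable_space[OF measurable_compose[OF measurable_T A]] by (auto simp: space_prob_algebra)

definition mean :: "((nat \<Rightarrow> 'z superclient) \<Rightarrow> 'w \<Rightarrow> real) \<Rightarrow> real" where
  "mean \<phi> = (\<integral>\<omega>. \<integral>w. \<phi> \<omega> w \<partial>A (T \<omega>) \<partial>\<Omega>)"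

text \<open>Additivity of \<open>mean\<close> needs integrability at both levels; requiring the
  inner one at every outcome allows the inner integral of a sum to be split pointwise.\<close>

definition mean_integrable :: "((nat \<Rightarrow> 'z superclient) \<Rightarrow> 'w \<Rightarrow> real) \<Rightarrow> bool" where
  "mean_integrable \<phi> \<longleftrightarrow> (\<forall>\<omega>\<in>space \<Omega>. integrable (A (T \<omega>)) (\<phi> \<omega>)) \<and> integrable \<Omega> (\<lambda>\<omega>. \<integral>w. \<phi> \<omega> w \<partial>A (T \<omega>))"

lemma mean_sum:
  assumes "\<And>k. k \<in> I \<Longrightarrow> mean_integrable (\<phi> k)"
  shows "mean (\<lambda>\<omega> w. \<Sum>k\<in>I. \<phi> k \<omega> w) = (\<Sum>k\<in>I. mean (\<phi> k))" "mean_integrable (\<lambda>\<omega> w. \<Sum>k\<in>I. \<phi> k \<omega> w)"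
proof -
  have "(\<integral>w. (\<Sum>k\<in>I. \<phi> k \<omega> w) \<partial>A (T \<omega>)) = (\<Sum>k\<in>I. \<integral>w. \<phi> k \<omega> w \<partial>A (T \<omega>))" if "\<omega> \<in> space \<Omega>" for \<omega>
    using assms that by (intro Bochner_Integration.integral_sum) (auto simp: mean_integrable_def)
  then show "mean (\<lambda>\<omega> w. \<Sum>k\<in>I. \<phi> k \<omega> w) = (\<Sum>k\<in>I. mean (\<phi> k))" "mean_integrable (\<lambda>\<omega> w. \<Sum>k\<in>I. \<phi> k \<omega> w)"
    unfolding mean_integrable_def mean_def using assms
    by (auto simp: mean_integrable_def cong: Bochner_Integration.integral_cong Bochner_Integration.integrable_cong)
qed

lemma mean_mult: "mean (\<lambda>\<omega> w. c * \<phi> \<omega> w) = c * mean \<phi>"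
  by (simp add: mean_def)

text \<open>Values in [0, 1] make both integrals finite, so identities between nonnegative integrals
  can be transferred to the real risks.\<close>

lemma mean_bounded:
  assumes \<phi>: "(\<lambda>(\<omega>, w). \<phi> \<omega> w) \<in> borel_measurable (\<Omega> \<Otimes>\<^sub>M MW)" 
    and b: "\<And>\<omega> w. \<omega> \<in> space \<Omega> \<Longrightarrow> w \<in> space MW \<Longrightarrow> 0 \<le> \<phi> \<omega> w \<and> \<phi> \<omega> w \<le> 1"
  shows "mean_integrable \<phi>" "ennreal (mean \<phi>) = (\<integral>\<^sup>+\<omega>. \<integral>\<^sup>+w. ennreal (\<phi> \<omega> w) \<partial>A (T \<omega>) \<partial>\<Omega>)" "0 \<le> mean \<phi>"
proof -
  have m: "(\<lambda>\<omega>. \<integral>w. \<phi> \<omega> w \<partial>A (T \<omega>)) \<in> borel_measurable \<Omega>"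
    by (rule integral_measurable_kernel[OF \<phi> measurable_prob_algebraD[OF measurable_compose[OF measurable_T A]]])
  have p: "prob_space (A (T \<omega>))" "\<phi> \<omega> \<in> borel_measurable (A (T \<omega>))"
     "\<And>w. w \<in> space (A (T \<omega>)) \<Longrightarrow> 0 \<le> \<phi> \<omega> w \<and> \<phi> \<omega> w \<le> 1" if \<omega>: "\<omega> \<in> space \<Omega>" for \<omega>
  proof -
    show "prob_space (A (T \<omega>))" using A_T[OF \<omega>] by simp
    have "\<phi> \<omega> \<in> borel_measurable MW" using measurable_compose[OF measurable_Pair1'[OF \<omega>] \<phi>] by simp
    then show "\<phi> \<omega> \<in> borel_measurable (A (T \<omega>))" using A_T[OF \<omega>] by (simp cong: measurable_cong_sets)
    fix w assume "w \<in> space (A (T \<omega>))"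
    then show "0 \<le> \<phi> \<omega> w \<and> \<phi> \<omega> w \<le> 1" using b[OF \<omega>] A_T[OF \<omega>] sets_eq_imp_space_eq[of "A (T \<omega>)" MW] by auto
  qed
  have bi: "integrable (A (T \<omega>)) (\<phi> \<omega>)" 
    "ennreal (\<integral>w. \<phi> \<omega> w \<partial>A (T \<omega>)) = (\<integral>\<^sup>+w. ennreal (\<phi> \<omega> w) \<partial>A (T \<omega>))"
    "0 \<le> (\<integral>w. \<phi> \<omega> w \<partial>A (T \<omega>)) \<and> (\<integral>w. \<phi> \<omega> w \<partial>A (T \<omega>)) \<le> 1" if "\<omega> \<in> space \<Omega>" for \<omega>
    using bounded_integral[OF p(1)[OF that] p(2)[OF that]] p(3)[OF that] by blast+
  note bo = bounded_integral[OF prob_\<Omega> m]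
  show "mean_integrable \<phi>" unfolding mean_integrable_def using bi(1,3) bo(1) by blast
  show "0 \<le> mean \<phi>" unfolding mean_def using bi(3) bo(3) by blast
  show "ennreal (mean \<phi>) = (\<integral>\<^sup>+\<omega>. \<integral>\<^sup>+w. ennreal (\<phi> \<omega> w) \<partial>A (T \<omega>) \<partial>\<Omega>)"
    unfolding mean_def using bo(2)[OF bi(3)] bi(2) by (simp cong: nn_integral_cong)
qed

lemma risk_mu:
  assumes "\<mu> \<in> space (prob_algebra MZ)" "w \<in> space MW"
  shows "0 \<le> risk_mu loss \<mu> w \<and> risk_mu loss \<mu> w \<le> 1" "ennreal (risk_mu loss \<mu> w) = (\<integral>\<^sup>+z. loss_ennreal w z \<partial>\<mu>)"
proof -
  have "(\<lambda>z. loss w z) \<in> borel_measurable MZ"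
    using measurable_loss[of "\<lambda>_. w" MZ "\<lambda>z. z"] assms by simp
  then have "(\<lambda>z. loss w z) \<in> borel_measurable \<mu>" "prob_space \<mu>"
    using assms by (auto simp: space_prob_algebra cong: measurable_cong_sets)
  note b = bounded_integral[OF this(2,1)]
  show "0 \<le> risk_mu loss \<mu> w \<and> risk_mu loss \<mu> w \<le> 1" "ennreal (risk_mu loss \<mu> w) = (\<integral>\<^sup>+z. loss_ennreal w z \<partial>\<mu>)"
    unfolding risk_mu_def loss_ennreal_def using b loss01 by auto
qed

lemma measurable_risk_mu:
  assumes "f \<in> N \<rightarrow>\<^sub>M MW" "g \<in> N \<rightarrow>\<^sub>M prob_algebra MZ" 
  shows "(\<lambda>x. risk_mu loss (g x) (f x)) \<in> borel_measurable N"
  unfolding risk_mu_def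
  by (rule integral_measurable_kernel[OF _ measurable_prob_algebraD[OF assms(2)]])
    (unfold split_beta', intro measurable_loss measurable_compose[OF measurable_fst assms(1)] measurable_snd)

lemma risk_D:
  assumes w: "w \<in> space MW"
  shows "0 \<le> risk_D loss D w \<and> risk_D loss D w \<le> 1" "ennreal (risk_D loss D w) = (\<integral>\<^sup>+\<mu>. \<integral>\<^sup>+z. loss_ennreal w z \<partial>\<mu> \<partial>D)"
proof -
  have sp: "\<mu> \<in> space D \<Longrightarrow> \<mu> \<in> space (prob_algebra MZ)" for \<mu> using sets_eq_imp_space_eq[OF sets_D] by simp
  have "(\<lambda>\<mu>. risk_mu loss \<mu> w) \<in> borel_measurable D"
    by (rule measurable_risk_mu[OF measurable_const[OF w] id_D])
  note b = bounded_integral[OF prob_D this risk_mu(1)[OF sp w]]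
  show "0 \<le> risk_D loss D w \<and> risk_D loss D w \<le> 1" "ennreal (risk_D loss D w) = (\<integral>\<^sup>+\<mu>. \<integral>\<^sup>+z. loss_ennreal w z \<partial>\<mu> \<partial>D)"
    unfolding risk_D_def using b risk_mu(2)[OF sp w] by (auto cong: nn_integral_cong)
qed

lemma measurable_risk_D_real:
  "(\<lambda>(\<omega>, w). risk_D loss D w) \<in> borel_measurable (\<Omega> \<Otimes>\<^sub>M MW)"
proof -
  interpret D: prob_space D by (rule prob_D)
  show ?thesis
    unfolding risk_D_def split_beta'
    by (rule D.borel_measurable_lebesgue_integral)
      (unfold split_beta', intro measurable_risk_mu measurable_compose[OF measurable_fst] measurable_snd measurable_compose[OF measurable_snd id_D])
qed

definition "pop_risk = mean (\<lambda>\<omega> w. risk_D loss D w)"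
definition "part_risk i = mean (\<lambda>\<omega> w. risk_mu loss (sc_mu (\<omega> i) (sc_V (\<omega> i))) w)"
definition "emp_risk i j = mean (\<lambda>\<omega> w. loss w (T \<omega> i j))"

lemma space_A_T: "\<omega> \<in> space \<Omega> \<Longrightarrow> space (A (T \<omega>)) = space MW"
  using A_T sets_eq_imp_space_eq by blast

lemma pop_risk:
  assumes "i < K" "j < n"
  shows "0 \<le> pop_risk" 
    "ennreal pop_risk = (\<integral>\<^sup>+x. row_loss i (training_row n x) (sc_Z x (\<not> sc_V x) j (\<not> sc_U x (\<not> sc_V x) j)) \<partial>SC)"
proof -
  have b: "0 \<le> pop_risk"
    "ennreal pop_risk = (\<integral>\<^sup>+\<omega>. \<integral>\<^sup>+w. ennreal (risk_D loss D w) \<partial>A (T \<omega>) \<partial>\<Omega>)"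
    unfolding pop_risk_def
    by (rule mean_bounded(3)[OF measurable_risk_D_real risk_D(1)], assumption)
       (rule mean_bounded(2)[OF measurable_risk_D_real risk_D(1)], assumption)
  show "0 \<le> pop_risk" by fact
  show "ennreal pop_risk = (\<integral>\<^sup>+x. row_loss i (training_row n x) (sc_Z x (\<not> sc_V x) j (\<not> sc_U x (\<not> sc_V x) j)) \<partial>SC)"
    unfolding b(2) population_risk_eq[OF assms, symmetric]
    by (intro nn_integral_cong risk_D(2)) (simp add: space_A_T)
qed

lemma part_risk:
  assumes i: "i < K"
  shows "0 \<le> part_risk i" "mean_integrable (\<lambda>\<omega> w. risk_mu loss (sc_mu (\<omega> i) (sc_V (\<omega> i))) w)"
    "\<And>j. j < n \<Longrightarrow> ennreal (part_risk i) = (\<integral>\<^sup>+x. row_loss i (training_row n x) (sc_Z x (sc_V x) j (\<not> sc_U x (sc_V x) j)) \<partial>SC)"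
proof -
  have mu: "(\<lambda>\<omega>. sc_mu (\<omega> i) (sc_V (\<omega> i))) \<in> \<Omega> \<rightarrow>\<^sub>M prob_algebra MZ"
    by (rule measurable_compose[OF measurable_client[OF i] measurable_own_mu])
  have m: "(\<lambda>(\<omega>, w). risk_mu loss (sc_mu (\<omega> i) (sc_V (\<omega> i))) w) \<in> borel_measurable (\<Omega> \<Otimes>\<^sub>M MW)"
    unfolding split_beta' by (intro measurable_risk_mu measurable_snd measurable_compose[OF measurable_fst mu])
  have bnd: "0 \<le> risk_mu loss (sc_mu (\<omega> i) (sc_V (\<omega> i))) w \<and> risk_mu loss (sc_mu (\<omega> i) (sc_V (\<omega> i))) w \<le> 1"
    if "\<omega> \<in> space \<Omega>" "w \<in> space MW" for \<omega> w
    by (rule risk_mu(1)[OF measurable_space[OF mu that(1)] that(2)])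
  note mean = mean_bounded[of "\<lambda>\<omega> w. risk_mu loss (sc_mu (\<omega> i) (sc_V (\<omega> i))) w", OF m]
  show "0 \<le> part_risk i" unfolding part_risk_def by (rule mean(3)) (rule bnd)
  show "mean_integrable (\<lambda>\<omega> w. risk_mu loss (sc_mu (\<omega> i) (sc_V (\<omega> i))) w)" by (rule mean(1)) (rule bnd)
  have b2: "ennreal (part_risk i) = (\<integral>\<^sup>+\<omega>. \<integral>\<^sup>+w. ennreal (risk_mu loss (sc_mu (\<omega> i) (sc_V (\<omega> i))) w) \<partial>A (T \<omega>) \<partial>\<Omega>)"
    unfolding part_risk_def by (rule mean(2)) (rule bnd)
  fix j assume j: "j < n"
  show "ennreal (part_risk i) = (\<integral>\<^sup>+x. row_loss i (training_row n x) (sc_Z x (sc_V x) j (\<not> sc_U x (sc_V x) j)) \<partial>SC)"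
    unfolding b2 participation_risk_eq[OF i j, symmetric]
    by (intro nn_integral_cong risk_mu(2) measurable_space[OF mu]) (simp_all add: space_A_T)
qed

lemma emp_risk:
  assumes i: "i < K" and j: "j < n"
  shows "0 \<le> emp_risk i j" "mean_integrable (\<lambda>\<omega> w. loss w (T \<omega> i j))"
    "ennreal (emp_risk i j) = (\<integral>\<^sup>+x. row_loss i (training_row n x) (sc_Z x (sc_V x) j (sc_U x (sc_V x) j)) \<partial>SC)"
proof -
  have "(\<lambda>\<omega>. sc_Z (\<omega> i) (sc_V (\<omega> i)) j (sc_U (\<omega> i) (sc_V (\<omega> i)) j)) \<in> \<Omega> \<rightarrow>\<^sub>M MZ"
    by (rule measurable_compose[OF measurable_client[OF i] measurable_train_pt[OF j]])
  then have pt: "(\<lambda>\<omega>. T \<omega> i j) \<in> \<Omega> \<rightarrow>\<^sub>M MZ" using i j by (simp add: train_sample_def)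
  have m: "(\<lambda>(\<omega>, w). loss w (T \<omega> i j)) \<in> borel_measurable (\<Omega> \<Otimes>\<^sub>M MW)"
    unfolding split_beta' by (intro measurable_loss measurable_snd measurable_compose[OF measurable_fst pt])
  note b = mean_bounded[of "\<lambda>\<omega> w. loss w (T \<omega> i j)", OF m loss01]
  show "0 \<le> emp_risk i j" unfolding emp_risk_def using b(3) .
  show "mean_integrable (\<lambda>\<omega> w. loss w (T \<omega> i j))" using b(1) .
  show "ennreal (emp_risk i j) = (\<integral>\<^sup>+x. row_loss i (training_row n x) (sc_Z x (sc_V x) j (sc_U x (sc_V x) j)) \<partial>SC)"
    unfolding emp_risk_def b(2) empirical_risk_eq[OF i j, symmetric] loss_ennreal_def ..
qed

text \<open>The argument common to both gaps: \<open>\<kappa> x c\<close> is the law of W given the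
  conditioning data in \<open>x\<close> and the bit value \<open>c\<close>, while \<open>p\<close>
  and \<open>q\<close> are the risks seen at the flipped and at the actual bit.\<close>

lemma gap_bound:
  fixes \<kappa> :: "'z superclient \<Rightarrow> bool \<Rightarrow> 'w measure" and g :: "'z superclient \<Rightarrow> 'w \<Rightarrow> bool \<Rightarrow> real"
  assumes i: "i < K"
    and \<kappa>: "\<And>x c. x \<in> space (sc_space MZ n) \<Longrightarrow> \<kappa> x c \<in> space (prob_algebra MW)"
    and g: "\<And>x b. x \<in> space (sc_space MZ n) \<Longrightarrow> (\<lambda>w. g x w b) \<in> borel_measurable MW"
    and g01: "\<And>x w b. 0 \<le> g x w b \<and> g x w b \<le> 1"
    and h: "\<And>B. (\<lambda>x. \<integral>\<^sup>+c. \<integral>\<^sup>+w. ennreal (g x w (B c)) \<partial>\<kappa> x c \<partial>coin) \<in> borel_measurable (sc_space MZ n)"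
    and p: "0 \<le> p" "ennreal p = (\<integral>\<^sup>+x. \<integral>\<^sup>+c. \<integral>\<^sup>+w. ennreal (g x w (\<not> c)) \<partial>\<kappa> x c \<partial>coin \<partial>SC)"
    and q: "0 \<le> q" "ennreal q = (\<integral>\<^sup>+x. \<integral>\<^sup>+c. \<integral>\<^sup>+w. ennreal (g x w c) \<partial>\<kappa> x c \<partial>coin \<partial>SC)"
  shows "ennreal \<bar>p - q\<bar> \<le> (\<integral>\<^sup>+\<omega>. sqrt2_ext (mutual_info_ext MW coin (bit_joint MW (\<kappa> (\<omega> i)))) \<partial>\<Omega>)"
proof -
  let ?J = "\<lambda>x. bit_joint MW (\<kappa> x)"
  define a where "a B x = (\<integral>p. g x (fst p) (B (snd p)) \<partial>?J x)" for B :: "bool \<Rightarrow> bool" and x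
  have a: "ennreal (a B x) = (\<integral>\<^sup>+c. \<integral>\<^sup>+w. ennreal (g x w (B c)) \<partial>\<kappa> x c \<partial>coin)" "0 \<le> a B x \<and> a B x \<le> 1"
    if x: "x \<in> space (sc_space MZ n)" for B x
  proof -
    have gb: "(\<lambda>p. g x (fst p) (B (snd p))) \<in> borel_measurable (MW \<Otimes>\<^sub>M coin)"
      by (rule measurable_compose_bit[OF g[OF x]])
    have gb': "(\<lambda>p. g x (fst p) (B (snd p))) \<in> borel_measurable (?J x)"
      using gb sets_bit_joint[OF \<kappa>[OF x]] by (simp cong: measurable_cong_sets)
    note b = bounded_integral[OF prob_bit_joint[OF \<kappa>[OF x]] gb' g01]
    show "0 \<le> a B x \<and> a B x \<le> 1" unfolding a_def using b(3) .
    show "ennreal (a B x) = (\<integral>\<^sup>+c. \<integral>\<^sup>+w. ennreal (g x w (B c)) \<partial>\<kappa> x c \<partial>coin)"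
      unfolding a_def b(2) using gb by (subst nn_integral_bit_joint[OF \<kappa>[OF x]]) auto
  qed
  \<comment> \<open>Measurability in \<open>x\<close> is read off the nonnegative integrals in
    \<open>h\<close>; no measurable dependence of the joint law on \<open>x\<close> is
    invoked.\<close>
  have am: "a B \<in> borel_measurable (sc_space MZ n)" for B
  proof -
    have "(\<lambda>x. enn2real (\<integral>\<^sup>+c. \<integral>\<^sup>+w. ennreal (g x w (B c)) \<partial>\<kappa> x c \<partial>coin)) \<in> borel_measurable (sc_space MZ n)"
      using h by measurable
    moreover have "enn2real (\<integral>\<^sup>+c. \<integral>\<^sup>+w. ennreal (g x w (B c)) \<partial>\<kappa> x c \<partial>coin) = a B x" 
      if "x \<in> space (sc_space MZ n)" for x using a[OF that, of B] by (metis enn2real_ennreal)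
    ultimately show ?thesis by (simp cong: measurable_cong)
  qed
  have int: "integrable \<Omega> (\<lambda>\<omega>. a B (\<omega> i))" 
      "ennreal (\<integral>\<omega>. a B (\<omega> i) \<partial>\<Omega>) = (\<integral>\<^sup>+x. \<integral>\<^sup>+c. \<integral>\<^sup>+w. ennreal (g x w (B c)) \<partial>\<kappa> x c \<partial>coin \<partial>SC)"
      "0 \<le> (\<integral>\<omega>. a B (\<omega> i) \<partial>\<Omega>)" for B
  proof -
    note b = bounded_integral[of \<Omega> "\<lambda>\<omega>. a B (\<omega> i)", OF prob_\<Omega> measurable_compose[OF measurable_client[OF i] am]]
    have a1: "0 \<le> a B (\<omega> i) \<and> a B (\<omega> i) \<le> 1" if "\<omega> \<in> space \<Omega>" for \<omega>
      by (rule a(2)[OF space_client[OF that i]])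
    show "integrable \<Omega> (\<lambda>\<omega>. a B (\<omega> i))" by (rule b(1)) (rule a1)
    show "0 \<le> (\<integral>\<omega>. a B (\<omega> i) \<partial>\<Omega>)" using b(3) a1 by blast
    have b2: "ennreal (\<integral>\<omega>. a B (\<omega> i) \<partial>\<Omega>) = (\<integral>\<^sup>+\<omega>. ennreal (a B (\<omega> i)) \<partial>\<Omega>)"
      by (rule b(2)) (rule a1)
    have "ennreal (\<integral>\<omega>. a B (\<omega> i) \<partial>\<Omega>) = (\<integral>\<^sup>+x. ennreal (a B x) \<partial>SC)"
      unfolding b2 unfolding omega_law_def
      by (rule nn_integral_PiM_component) (use prob_SC i am in auto)
    also have "\<dots> = (\<integral>\<^sup>+x. \<integral>\<^sup>+c. \<integral>\<^sup>+w. ennreal (g x w (B c)) \<partial>\<kappa> x c \<partial>coin \<partial>SC)"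
      by (intro nn_integral_cong a(1)) (simp add: space_SC)
    finally show "ennreal (\<integral>\<omega>. a B (\<omega> i) \<partial>\<Omega>) = \<dots>" .
  qed
  \<comment> \<open>Both sides are nonnegative reals with the same image under
    \<open>ennreal\<close>, which is injective there.\<close>
  have "p = (\<integral>\<omega>. a Not (\<omega> i) \<partial>\<Omega>)" "q = (\<integral>\<omega>. a (\<lambda>c. c) (\<omega> i) \<partial>\<Omega>)"
    by (rule iffD1[OF ennreal_inj[OF p(1) int(3)]], simp only: p(2) int(2))
      (rule iffD1[OF ennreal_inj[OF q(1) int(3)]], simp only: q(2) int(2))
  moreover have "ennreal \<bar>(\<integral>\<omega>. a Not (\<omega> i) \<partial>\<Omega>) - (\<integral>\<omega>. a (\<lambda>c. c) (\<omega> i) \<partial>\<Omega>)\<bar> 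
     \<le> (\<integral>\<^sup>+\<omega>. sqrt2_ext (mutual_info_ext MW coin (?J (\<omega> i))) \<partial>\<Omega>)"
  proof (rule abs_integral_diff_le_nn_integral[OF int(1) int(1)])
    fix \<omega> assume "\<omega> \<in> space \<Omega>"
    from space_client[OF this i] have x: "\<omega> i \<in> space (sc_space MZ n)" .
    show "ennreal \<bar>a Not (\<omega> i) - a (\<lambda>c. c) (\<omega> i)\<bar> \<le> sqrt2_ext (mutual_info_ext MW coin (?J (\<omega> i)))"
      unfolding a_def by (rule bit_joint_mutual_info_bound[OF \<kappa>[OF x] g[OF x] g01])
  qed
  ultimately show ?thesis by simp
qed

end

section \<open>The two gaps\<close>

lemma ennreal_abs_scaled_sum_le:
  assumes "\<And>k. k \<in> I \<Longrightarrow> ennreal \<bar>f k\<bar> \<le> B k" "0 \<le> c"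
  shows "ennreal \<bar>c * (\<Sum>k\<in>I. f k)\<bar> \<le> ennreal c * (\<Sum>k\<in>I. B k)"
proof -
  have "ennreal \<bar>c * (\<Sum>k\<in>I. f k)\<bar> \<le> ennreal (c * (\<Sum>k\<in>I. \<bar>f k\<bar>))"
    using assms(2) by (intro ennreal_leI) (simp add: abs_mult mult_left_mono)
  also have "\<dots> = ennreal c * (\<Sum>k\<in>I. ennreal \<bar>f k\<bar>)"
    using assms(2) by (simp add: ennreal_mult sum_nonneg)
  also have "\<dots> \<le> ennreal c * (\<Sum>k\<in>I. B k)"
    by (intro mult_left_mono sum_mono assms) auto
  finally show ?thesis .
qed

context fl_setting begin

text \<open>The training row does not read the client distributions, so it makes no difference that
  \<open>Wlaw_V\<close> takes them from the environment and not from \<open>x\<close>.\<close>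

lemma joint_W_V_eq:
  assumes i: "i < K"
  shows "joint_W_V MZ MW D K n A i (sc_Z x) (sc_U x) = bit_joint MW (\<lambda>v. row_kernel i (training_row n (sc_mu x, sc_Z x, v, sc_U x)))"
proof -
  have "training_row n (sc_mu (\<omega> i), sc_Z x, v, sc_U x) = training_row n (sc_mu x, sc_Z x, v, sc_U x)" 
    for \<omega> :: "nat \<Rightarrow> 'z superclient" and v
    by (simp add: training_row_def)
  then show ?thesis
    by (simp add: joint_W_V_def bit_joint_def Wlaw_V_def row_kernel_def train_sample_upd[OF i])
qed

lemma measurable_ghost:
  fixes B :: "bool \<Rightarrow> bool"
  assumes i: "i < K" and j: "j < n"
  shows "(\<lambda>x. row_loss i (training_row n x) (sc_Z x (B (sc_V x)) j (\<not> sc_U x (B (sc_V x)) j))) \<in> borel_measurable (sc_space MZ n)"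
proof -
  have BV: "Measurable.pred (sc_space MZ n) (\<lambda>x. B (sc_V x))"
    using measurable_compose[OF measurable_sc_V, of B "count_space UNIV"] by simp
  have UV: "Measurable.pred (sc_space MZ n) (\<lambda>x. \<not> sc_U x (B (sc_V x)) j)"
    using measurable_bits_apply[OF j measurable_sc_U BV] by measurable
  show ?thesis
    by (rule measurable_row_loss[OF i measurable_training_row measurable_ss_apply[OF j measurable_sc_Z BV UV]])
qed

lemma measurable_own:
  fixes B :: "bool \<Rightarrow> bool"
  assumes i: "i < K" and j: "j < n"
  shows "(\<lambda>x. row_loss i (training_row n x) (sc_Z x (sc_V x) j (B (sc_U x (sc_V x) j)))) \<in> borel_measurable (sc_space MZ n)"
proof -
  have UV: "Measurable.pred (sc_space MZ n) (\<lambda>x. B (sc_U x (sc_V x) j))"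
    using measurable_compose[OF measurable_bits_apply[OF j measurable_sc_U measurable_sc_V], of B "count_space UNIV"] by simp
  show ?thesis
    by (rule measurable_row_loss[OF i measurable_training_row measurable_ss_apply[OF j measurable_sc_Z measurable_sc_V UV]])
qed

lemma space_sc_Z: "x \<in> space (sc_space MZ n) \<Longrightarrow> j < n \<Longrightarrow> sc_Z x b j c \<in> space MZ"
  by (rule measurable_space[OF measurable_ss_apply[OF _ measurable_sc_Z]]) auto

lemma measurable_loss_at: "y \<in> space MZ \<Longrightarrow> (\<lambda>w. loss w y) \<in> borel_measurable MW"
  using measurable_loss[of "\<lambda>w. w" MW "\<lambda>_. y"] by simp

lemma participation_bound:
  assumes i: "i < K"
  shows "ennreal \<bar>pop_risk - part_risk i\<bar> 
    \<le> (\<integral>\<^sup>+\<omega>. sqrt2_ext (mutual_info_ext MW coin (joint_W_V MZ MW D K n A i (sc_Z (\<omega> i)) (sc_U (\<omega> i)))) \<partial>\<Omega>)"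
proof -
  have j: "0 < n" using n by simp
  let ?\<kappa> = "\<lambda>x v. row_kernel i (training_row n (sc_mu x, sc_Z x, v, sc_U x))"
  \<comment> \<open>The complementary point at position 0, which exists because n is at least 1. It
    is determined by the supersample, U and the bit b; at b = V it stands for the client risk, at
    the other value for the population risk.\<close>
  let ?g = "\<lambda>x w b. loss w (sc_Z x b 0 (\<not> sc_U x b 0))"
  \<comment> \<open>Overwriting V in \<open>x\<close> by the fair bit makes the two sides agree, so
    the resampling formula for V applies to the function of \<open>x\<close> displayed on the
    right.\<close>
  have F: "(\<integral>\<^sup>+c. \<integral>\<^sup>+w. ennreal (?g x w (B c)) \<partial>?\<kappa> x c \<partial>coin) = 
    (\<integral>\<^sup>+v. (\<lambda>x. row_loss i (training_row n x) (sc_Z x (B (sc_V x)) 0 (\<not> sc_U x (B (sc_V x)) 0))) (sc_mu x, sc_Z x, v, sc_U x) \<partial>coin)" for B x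
    by (simp add: row_loss_def loss_ennreal_def)
  have "ennreal \<bar>pop_risk - part_risk i\<bar> \<le> (\<integral>\<^sup>+\<omega>. sqrt2_ext (mutual_info_ext MW coin (bit_joint MW (?\<kappa> (\<omega> i)))) \<partial>\<Omega>)"
  proof (rule gap_bound[where g="?g" and \<kappa>="?\<kappa>", OF i _ _ loss01 _ pop_risk(1)[OF i j] _ part_risk(1)[OF i]])
    fix x c assume x: "x \<in> space (sc_space MZ n)"
    have "(sc_mu x, sc_Z x, c, sc_U x) \<in> space (sc_space MZ n)"
      using x by (auto simp: sc_space_eq space_pair_measure sc_mu_def sc_Z_def sc_U_def)
    then show "?\<kappa> x c \<in> space (prob_algebra MW)"
      by (rule measurable_space[OF measurable_compose[OF measurable_training_row measurable_row_kernel[OF i]]])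
    show "(\<lambda>w. ?g x w c) \<in> borel_measurable MW"
      by (rule measurable_loss_at[OF space_sc_Z[OF x j]])
  next
    show "(\<lambda>x. \<integral>\<^sup>+c. \<integral>\<^sup>+w. ennreal (?g x w (B c)) \<partial>?\<kappa> x c \<partial>coin) \<in> borel_measurable (sc_space MZ n)" for B
      unfolding F by (rule measurable_resample_V[OF measurable_ghost[OF i j]])
    show "ennreal pop_risk = (\<integral>\<^sup>+x. \<integral>\<^sup>+c. \<integral>\<^sup>+w. ennreal (?g x w (\<not> c)) \<partial>?\<kappa> x c \<partial>coin \<partial>SC)"
      unfolding F[of _ Not] pop_risk(2)[OF i j]
      by (rule nn_integral_SC_resample_V[OF measurable_ghost[OF i j]])
    show "ennreal (part_risk i) = (\<integral>\<^sup>+x. \<integral>\<^sup>+c. \<integral>\<^sup>+w. ennreal (?g x w c) \<partial>?\<kappa> x c \<partial>coin \<partial>SC)"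
      unfolding F[of _ "\<lambda>c. c"] part_risk(3)[OF i j]
      by (rule nn_integral_SC_resample_V[OF measurable_ghost[OF i j]])
  qed
  then show ?thesis by (simp add: joint_W_V_eq[OF i])
qed

text \<open>\<open>x\<close> carries the conditioning data, \<open>x'\<close> is an independent
  superclient used only for its remaining bits.\<close>

definition set_bit :: "nat \<Rightarrow> 'z superclient \<Rightarrow> bool \<Rightarrow> 'z superclient \<Rightarrow> 'z superclient" where
  "set_bit j x c x' = (sc_mu x, sc_Z x, sc_V x, fun_upd (sc_U x') (sc_V x) (fun_upd (sc_U x' (sc_V x)) j c))"

lemma set_bit_simps[simp]: "sc_Z (set_bit j x c x') = sc_Z x" "sc_V (set_bit j x c x') = sc_V x"
  "sc_U (set_bit j x c x') (sc_V x) j = c"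
  by (simp_all add: set_bit_def)

lemma measurable_set_bit:
  assumes x: "x \<in> space (sc_space MZ n)" and j: "j < n"
  shows "set_bit j x c \<in> sc_space MZ n \<rightarrow>\<^sub>M sc_space MZ n"
  unfolding set_bit_def
  by (intro measurable_sc_tuple measurable_bits_upd[OF j] measurable_sc_U)
    (use x in \<open>auto simp: sc_space_eq space_pair_measure sc_mu_def sc_Z_def sc_V_def\<close>)

lemma Wlaw_U_eq:
  assumes i: "i < K"
  shows "Wlaw_U MZ D K n A i j (sc_Z x) (sc_V x) c = bind \<Omega> (\<lambda>\<omega>. A (fun_upd (T \<omega>) i (training_row n (set_bit j x c (\<omega> i)))))"
proof -
  have "training_row n (sc_mu (\<omega> i), sc_Z x, sc_V x, u) = training_row n (sc_mu x, sc_Z x, sc_V x, u)" 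
    for \<omega> :: "nat \<Rightarrow> 'z superclient" and u
    by (simp add: training_row_def)
  then show ?thesis
    by (simp add: Wlaw_U_def train_sample_upd[OF i] set_bit_def)
qed

text \<open>In \<open>Wlaw_U\<close> the i-th superclient of the environment contributes bits, while
  the others contribute training rows. Taking coordinate i to the outside as \<open>x'\<close>
  separates these roles and exhibits the law as a mixture of row kernels.\<close>

lemma
  assumes i: "i < K" and j: "j < n" and x: "x \<in> space (sc_space MZ n)"
  shows Wlaw_U_prob: "Wlaw_U MZ D K n A i j (sc_Z x) (sc_V x) c \<in> space (prob_algebra MW)"
    and nn_integral_Wlaw_U: "f \<in> borel_measurable MW \<Longrightarrow> (\<integral>\<^sup>+w. f w \<partial>Wlaw_U MZ D K n A i j (sc_Z x) (sc_V x) c) = 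
      (\<integral>\<^sup>+x'. \<integral>\<^sup>+w. f w \<partial>row_kernel i (training_row n (set_bit j x c x')) \<partial>SC)"
proof -
  have row: "(\<lambda>x'. training_row n (set_bit j x c x')) \<in> sc_space MZ n \<rightarrow>\<^sub>M row_space"
    by (rule measurable_compose[OF measurable_set_bit[OF x j] measurable_training_row])
  have ker: "(\<lambda>\<omega>. A (fun_upd (T \<omega>) i (training_row n (set_bit j x c (\<omega> i))))) \<in> \<Omega> \<rightarrow>\<^sub>M prob_algebra MW"
    by (intro measurable_compose[OF _ A] measurable_T_upd[OF i] measurable_ident_sets[OF refl] 
       measurable_compose[OF measurable_client[OF i] row])
  show "Wlaw_U MZ D K n A i j (sc_Z x) (sc_V x) c \<in> space (prob_algebra MW)"
    unfolding Wlaw_U_eq[OF i]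
    using prob_space_bind'[OF \<Omega>_in_prob_algebra ker] sets_bind'[OF \<Omega>_in_prob_algebra ker]
    by (simp add: space_prob_algebra)
  assume f: "f \<in> borel_measurable MW"
  have m: "(\<lambda>\<omega>. \<integral>\<^sup>+w. f w \<partial>A (fun_upd (T \<omega>) i (training_row n (set_bit j x c (\<omega> i))))) \<in> borel_measurable \<Omega>"
    by (rule measurable_compose[OF measurable_prob_algebraD[OF ker] nn_integral_measurable_subprob_algebra[OF f]])
  have "(\<integral>\<^sup>+w. f w \<partial>Wlaw_U MZ D K n A i j (sc_Z x) (sc_V x) c) = 
     (\<integral>\<^sup>+\<omega>. \<integral>\<^sup>+w. f w \<partial>A (fun_upd (T \<omega>) i (training_row n (set_bit j x c (\<omega> i)))) \<partial>\<Omega>)"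
    unfolding Wlaw_U_eq[OF i] by (rule nn_integral_bind[OF f measurable_prob_algebraD[OF ker]])
  also have "\<dots> = (\<integral>\<^sup>+x'. \<integral>\<^sup>+\<omega>. \<integral>\<^sup>+w. f w \<partial>A (fun_upd (T \<omega>) i (training_row n (set_bit j x c x'))) \<partial>\<Omega> \<partial>SC)"
    using nn_integral_PiM_resample(2)[of "{..<K}" "\<lambda>_. SC" i, OF _ _ m[unfolded omega_law_def]] i prob_SC
    by (simp add: omega_law_def train_sample_upd)
  also have "\<dots> = (\<integral>\<^sup>+x'. \<integral>\<^sup>+w. f w \<partial>row_kernel i (training_row n (set_bit j x c x')) \<partial>SC)"
    by (intro nn_integral_cong nn_integral_row_kernel[symmetric] f i measurable_space[OF row]) (simp add: space_SC)
  finally show "(\<integral>\<^sup>+w. f w \<partial>Wlaw_U MZ D K n A i j (sc_Z x) (sc_V x) c) = 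
      (\<integral>\<^sup>+x'. \<integral>\<^sup>+w. f w \<partial>row_kernel i (training_row n (set_bit j x c x')) \<partial>SC)" .
qed

lemma out_of_sample_bound:
  assumes i: "i < K" and j: "j < n"
  shows "ennreal \<bar>part_risk i - emp_risk i j\<bar> 
    \<le> (\<integral>\<^sup>+\<omega>. sqrt2_ext (mutual_info_ext MW coin (joint_W_U MZ MW D K n A i j (sc_Z (\<omega> i)) (sc_V (\<omega> i)))) \<partial>\<Omega>)"
proof -
  let ?\<kappa> = "\<lambda>x c. Wlaw_U MZ D K n A i j (sc_Z x) (sc_V x) c"
  \<comment> \<open>Both points at position j of the selected client are known from the supersample
    and V. The bit tells which of them was used for training: its value gives the empirical loss,
    its negation the ghost point.\<close>
  let ?g = "\<lambda>x w c. loss w (sc_Z x (sc_V x) j c)"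
  let ?F = "\<lambda>B x. row_loss i (training_row n x) (sc_Z x (sc_V x) j (B (sc_U x (sc_V x) j)))"
  have F: "(\<integral>\<^sup>+c. \<integral>\<^sup>+w. ennreal (?g x w (B c)) \<partial>?\<kappa> x c \<partial>coin) = (\<integral>\<^sup>+c. \<integral>\<^sup>+x'. ?F B (set_bit j x c x') \<partial>SC \<partial>coin)" 
    if x: "x \<in> space (sc_space MZ n)" for B x
    using measurable_compose[OF measurable_loss_at[OF space_sc_Z[OF x j]] measurable_ennreal]
    by (subst nn_integral_Wlaw_U[OF i j x]) (auto simp: row_loss_def loss_ennreal_def)
  have "ennreal \<bar>part_risk i - emp_risk i j\<bar> \<le> (\<integral>\<^sup>+\<omega>. sqrt2_ext (mutual_info_ext MW coin (bit_joint MW (?\<kappa> (\<omega> i)))) \<partial>\<Omega>)"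
  proof (rule gap_bound[where g="?g" and \<kappa>="?\<kappa>", OF i _ _ loss01 _ part_risk(1)[OF i] _ emp_risk(1)[OF i j]])
    fix x c assume x: "x \<in> space (sc_space MZ n)"
    show "?\<kappa> x c \<in> space (prob_algebra MW)" by (rule Wlaw_U_prob[OF i j x])
    show "(\<lambda>w. ?g x w c) \<in> borel_measurable MW"
      by (rule measurable_loss_at[OF space_sc_Z[OF x j]])
  next
    show "(\<lambda>x. \<integral>\<^sup>+c. \<integral>\<^sup>+w. ennreal (?g x w (B c)) \<partial>?\<kappa> x c \<partial>coin) \<in> borel_measurable (sc_space MZ n)" for B
      using measurable_resample_bit[OF measurable_own[OF i j, of B] j] F[of _ B]
      by (simp add: set_bit_def[symmetric] cong: measurable_cong)
    have eq: "(\<integral>\<^sup>+x. ?F B x \<partial>SC) = (\<integral>\<^sup>+x. \<integral>\<^sup>+c. \<integral>\<^sup>+w. ennreal (?g x w (B c)) \<partial>?\<kappa> x c \<partial>coin \<partial>SC)" for B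
      unfolding nn_integral_SC_resample_bit[OF measurable_own[OF i j, of B] j] set_bit_def[symmetric]
      by (intro nn_integral_cong F[symmetric]) (simp add: space_SC)
    show "ennreal (part_risk i) = (\<integral>\<^sup>+x. \<integral>\<^sup>+c. \<integral>\<^sup>+w. ennreal (?g x w (\<not> c)) \<partial>?\<kappa> x c \<partial>coin \<partial>SC)"
      unfolding part_risk(3)[OF i j] by (rule eq[of Not])
    show "ennreal (emp_risk i j) = (\<integral>\<^sup>+x. \<integral>\<^sup>+c. \<integral>\<^sup>+w. ennreal (?g x w c) \<partial>?\<kappa> x c \<partial>coin \<partial>SC)"
      unfolding emp_risk(3)[OF i j] by (rule eq[of "\<lambda>c. c"])
  qed
  then show ?thesis by (simp add: joint_W_U_def bit_joint_def)
qed

section \<open>Assembling the averaged bounds\<close>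

lemma exp_pop_risk_eq: "exp_pop_risk MZ D K n A loss = pop_risk"
  by (simp add: exp_pop_risk_def pop_risk_def mean_def)

lemma exp_part_risk_eq: "exp_part_risk MZ D K n A loss = (1 / real K) * (\<Sum>i<K. part_risk i)"
proof -
  have "exp_part_risk MZ D K n A loss = mean (\<lambda>\<omega> w. (1 / real K) * (\<Sum>i<K. risk_mu loss (sc_mu (\<omega> i) (sc_V (\<omega> i))) w))"
    unfolding exp_part_risk_def mean_def ..
  also have "\<dots> = (1 / real K) * (\<Sum>i<K. part_risk i)"
    unfolding mean_mult part_risk_def by (subst mean_sum(1)) (auto intro: part_risk(2))
  finally show ?thesis .
qed

lemma exp_emp_risk_eq: "exp_emp_risk MZ D K n A loss = (1 / (real K * real n)) * (\<Sum>i<K. \<Sum>j<n. emp_risk i j)"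
proof -
  have "exp_emp_risk MZ D K n A loss = mean (\<lambda>\<omega> w. (1 / (real K * real n)) * (\<Sum>i<K. \<Sum>j<n. loss w (T \<omega> i j)))"
    unfolding exp_emp_risk_def mean_def ..
  also have "\<dots> = (1 / (real K * real n)) * (\<Sum>i<K. mean (\<lambda>\<omega> w. \<Sum>j<n. loss w (T \<omega> i j)))"
    unfolding mean_mult by (subst mean_sum(1)) (auto intro: emp_risk(2) mean_sum(2))
  also have "\<dots> = (1 / (real K * real n)) * (\<Sum>i<K. \<Sum>j<n. emp_risk i j)"
  proof -
    have "mean (\<lambda>\<omega> w. \<Sum>j<n. loss w (T \<omega> i j)) = (\<Sum>j<n. emp_risk i j)" if "i < K" for i
      unfolding emp_risk_def by (rule mean_sum(1)) (use that emp_risk(2) in auto)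
    then show ?thesis by simp
  qed
  finally show ?thesis .
qed

lemma part_gap_bound: "ennreal \<bar>part_gap MZ D K n A loss\<bar> \<le> bound_PG MZ MW D K n A"
proof -
  \<comment> \<open>The population risk is the same for every client, so it can be distributed over
    the K summands.\<close>
  have "part_gap MZ D K n A loss = (1 / real K) * (\<Sum>i<K. pop_risk - part_risk i)"
    using K by (simp add: part_gap_def exp_pop_risk_eq exp_part_risk_eq sum_subtractf field_simps)
  then show ?thesis
    unfolding bound_PG_def by (simp only:) (rule ennreal_abs_scaled_sum_le, auto intro: participation_bound)
qed

lemma out_gap_bound: "ennreal \<bar>out_gap MZ D K n A loss\<bar> \<le> bound_OG MZ MW D K n A"
proof -
  \<comment> \<open>Each client risk is repeated n times, which turns the factor 1/K into 1/(Kn) and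
    pairs it with every training point.\<close>
  have "out_gap MZ D K n A loss = (1 / (real K * real n)) * (\<Sum>i<K. \<Sum>j<n. part_risk i - emp_risk i j)"
    using K n by (simp add: out_gap_def exp_part_risk_eq exp_emp_risk_eq sum_subtractf sum_distrib_left[symmetric] field_simps)
  also have "\<dots> = (1 / (real K * real n)) * (\<Sum>(i, j)\<in>{..<K} \<times> {..<n}. part_risk i - emp_risk i j)"
    by (simp add: sum.cartesian_product)
  finally show ?thesis
    unfolding bound_OG_def sum.cartesian_product 
    by (simp only:) (rule ennreal_abs_scaled_sum_le, auto intro: out_of_sample_bound)
qed

lemma gen_error_bound: "ennreal \<bar>gen_error MZ D K n A loss\<bar> \<le> bound_PG MZ MW D K n A + bound_OG MZ MW D K n A"
proof -
  \<comment> \<open>The participation risk cancels in the sum of the two gaps, so the triangle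
    inequality finishes the estimate.\<close>
  have "ennreal \<bar>gen_error MZ D K n A loss\<bar> \<le> ennreal (\<bar>part_gap MZ D K n A loss\<bar> + \<bar>out_gap MZ D K n A loss\<bar>)"
    by (rule ennreal_leI) (simp add: gen_error_def part_gap_def out_gap_def)
  also have "\<dots> \<le> bound_PG MZ MW D K n A + bound_OG MZ MW D K n A"
    by (simp add: add_mono part_gap_bound out_gap_bound)
  finally show ?thesis .
qed

end

theorem theorem1:
  fixes MZ :: "'z measure" and MW :: "'w measure" and MWloc :: "'l measure"
    and D :: "'z measure measure"
    and K n :: nat
    and A :: "(nat \<Rightarrow> nat \<Rightarrow> 'z) \<Rightarrow> 'w measure"
    and loss :: "'w \<Rightarrow> 'z \<Rightarrow> real"
  assumes "K \<ge> 1" and "n \<ge> 1"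
    and "prob_space D" and "sets D = sets (prob_algebra MZ)"
    and "fl_algorithm MZ MWloc MW K n A"
    and "(\<lambda>(w, z). loss w z) \<in> borel_measurable (MW \<Otimes>\<^sub>M MZ)"
    and "\<And>w z. 0 \<le> loss w z \<and> loss w z \<le> 1"
  shows "ennreal \<bar>gen_error MZ D K n A loss\<bar>
           \<le> bound_PG MZ MW D K n A + bound_OG MZ MW D K n A
         \<and> ennreal \<bar>part_gap MZ D K n A loss\<bar> \<le> bound_PG MZ MW D K n A
         \<and> ennreal \<bar>out_gap MZ D K n A loss\<bar> \<le> bound_OG MZ MW D K n A"
proof -
  have A: "A \<in> sample_space MZ K n \<rightarrow>\<^sub>M prob_algebra MW"
    using assms(5) unfolding fl_algorithm_def by (rule conjunct1)
  interpret fl_setting MZ D n MW K A loss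
    by (intro fl_setting.intro superclient.intro fl_setting_axioms.intro) (rule assms A)+
  show ?thesis using gen_error_bound part_gap_bound out_gap_bound by blast
qed

end
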